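(* Let $P$ be a finite poset and $k[P]$ the incidence algebra of $P$ over a field $k$. For any (not necessarily convex) full subposet $Q$ of $P$, the interval resolution global dimension of $k[Q]$ is smaller than or equal to that of $k[P]$.
   Context: For a finite poset $P$, the Hasse diagram of $P$ is the quiver with vertex set $P$ and an arrow $x\to y$ if and only if $x<y$ and there is no $z\in P$ with $x<z<y$. The incidence algebra $k[P]$ is the quotient of the path algebra over $k$ of the Hasse diagram by the two-sided ideal generated by all commutativity relations (differences of parallel paths). All modules are finitely generated right modules; $k[P]$-modules are identified with functors from $P$ (viewed as a category with a unique morphism $a\to b$ iff $a\le b$) to finite dimensional $k$-vector spaces. A full subposet is a subset with the induced order. An interval of $P$ is a (nonempty) full subposet $I$ which is connected as a poset and convex in $P$ (if $x,y\in I$, $z\in P$ and $x<z<y$, then $z\in I$). For an interval $I$, the module $k_I$ has $(k_I)_a=k$ if $a\in I$ and $0$ otherwise, and $k_I(a\le b)=1_k$ if $a,b\in I$ and $0$ otherwise. Interval modules are the modules isomorphic to some $k_I$; a module is interval-decomposable if it is isomorphic to a finite direct sum of interval modules. An interval cover of $M$ is a morphism $f\colon X\to M$ with $X$ interval-decomposable such that $\mathrm{Hom}(Y,f)$ is surjective for every interval-decomposable $Y$, and such that every $g\colon X\to X$ with $fg=f$ is an isomorphism. Every $k[P]$-module has an interval cover, unique up to isomorphism, and it is surjective. Let $\Omega(M)$ be the kernel of the interval cover of $M$, $\Omega^0(M)=M$ and $\Omega^i(M)=\Omega(\Omega^{i-1}(M))$. The interval resolution dimension of $M$ is $m$ if $m\ge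 0$ is the smallest integer with $\Omega^{m+1}(M)=0$ (that is, the minimal resolution obtained by iterating interval covers has the form $0\to J_m\to\cdots\to J_0\to M\to 0$), and $\infty$ if there is no such $m$. The interval resolution global dimension of $k[P]$ is the supremum of the interval resolution dimensions of all $k[P]$-modules. *)

theory Defs
  imports Complex_Main "HOL-Library.Function_Algebras" "HOL-Library.Extended_Nat"
begin

text \<open>
  A finite poset is a finite subset \<open>P\<close> of a type of class \<open>order\<close>; a full subposet is a
  subset \<open>Q \<subseteq> P\<close>, with the same order.  Every notion below is relative to such a set, so
  that convexity and connectedness of an interval of \<open>Q\<close> only involve the elements of \<open>Q\<close>.
\<close>

definition poset_connected :: "'p::order set \<Rightarrow> bool" where
  "poset_connected I \<longleftrightarrow> (\<forall>x\<in>I. \<forall>y\<in>I. (x, y) \<in> {(u, v). u \<in> I \<and> v \<in> I \<and> (u \<le> v \<or> v \<le> u)}\<^sup>*)"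

definition poset_convex :: "'p::order set \<Rightarrow> 'p set \<Rightarrow> bool" where
  "poset_convex P I \<longleftrightarrow> (\<forall>x\<in>I. \<forall>y\<in>I. \<forall>z\<in>P. x < z \<and> z < y \<longrightarrow> z \<in> I)"

definition interval :: "'p::order set \<Rightarrow> 'p set \<Rightarrow> bool" where
  "interval P I \<longleftrightarrow> I \<subseteq> P \<and> I \<noteq> {} \<and> poset_connected I \<and> poset_convex P I"


text \<open>
  Vector spaces over \<open>'k\<close> are realised as subspaces of the function space \<open>'i \<Rightarrow> 'k\<close>
  (with pointwise operations).  For \<open>'i = nat\<close> this space is infinite-dimensional, so every
  finite-dimensional vector space is isomorphic to a subspace of it.
\<close>

definition fscale :: "'k::field \<Rightarrow> ('i \<Rightarrow> 'k) \<Rightarrow> 'i \<Rightarrow> 'k" where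
  "fscale c x = (\<lambda>i. c * x i)"

interpretation fspace: vector_space "fscale :: 'k::field \<Rightarrow> ('i \<Rightarrow> 'k) \<Rightarrow> 'i \<Rightarrow> 'k"
  by unfold_locales (auto simp: fscale_def fun_eq_iff algebra_simps)

definition fd_subspace :: "('i \<Rightarrow> 'k::field) set \<Rightarrow> bool" where
  "fd_subspace S \<longleftrightarrow> (\<exists>B. finite B \<and> S = fspace.span B)"

definition lin_map :: "('i \<Rightarrow> 'k::field) set \<Rightarrow> ('j \<Rightarrow> 'k) set \<Rightarrow> (('i \<Rightarrow> 'k) \<Rightarrow> 'j \<Rightarrow> 'k) \<Rightarrow> bool" where
  "lin_map S T f \<longleftrightarrow> f ` S \<subseteq> T \<and> (\<forall>x\<in>S. \<forall>y\<in>S. f (x + y) = f x + f y)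
     \<and> (\<forall>c. \<forall>x\<in>S. f (fscale c x) = fscale c (f x))"


text \<open>
  A \<open>k[P]\<close>-module is a functor from \<open>P\<close> to finite-dimensional vector spaces.  The values of
  \<open>sp\<close> and \<open>tr\<close> outside \<open>P\<close>, and those of linear maps outside their domain, are irrelevant;
  accordingly all equations between morphisms are only required on the domain.
\<close>

record ('p, 'i, 'k) rep =
  sp :: "'p \<Rightarrow> ('i \<Rightarrow> 'k) set"
  tr :: "'p \<Rightarrow> 'p \<Rightarrow> ('i \<Rightarrow> 'k) \<Rightarrow> 'i \<Rightarrow> 'k"

definition pmodule :: "'p::order set \<Rightarrow> ('p, 'i, 'k::field) rep \<Rightarrow> bool" where
  "pmodule P M \<longleftrightarrow>
     (\<forall>a\<in>P. fd_subspace (sp M a)) \<and>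
     (\<forall>a\<in>P. \<forall>b\<in>P. a \<le> b \<longrightarrow> lin_map (sp M a) (sp M b) (tr M a b)) \<and>
     (\<forall>a\<in>P. \<forall>x\<in>sp M a. tr M a a x = x) \<and>
     (\<forall>a\<in>P. \<forall>b\<in>P. \<forall>c\<in>P. a \<le> b \<and> b \<le> c \<longrightarrow>
        (\<forall>x\<in>sp M a. tr M b c (tr M a b x) = tr M a c x))"

definition zero_module :: "'p set \<Rightarrow> ('p, 'i, 'k::field) rep \<Rightarrow> bool" where
  "zero_module P M \<longleftrightarrow> (\<forall>a\<in>P. sp M a = {0})"

definition pmorphism :: "'p::order set \<Rightarrow> ('p, 'i, 'k::field) rep \<Rightarrow> ('p, 'j, 'k) rep
    \<Rightarrow> ('p \<Rightarrow> ('i \<Rightarrow> 'k) \<Rightarrow> 'j \<Rightarrow> 'k) \<Rightarrow> bool" where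
  "pmorphism P M N f \<longleftrightarrow>
     (\<forall>a\<in>P. lin_map (sp M a) (sp N a) (f a)) \<and>
     (\<forall>a\<in>P. \<forall>b\<in>P. a \<le> b \<longrightarrow> (\<forall>x\<in>sp M a. f b (tr M a b x) = tr N a b (f a x)))"

definition pisomorphism :: "'p::order set \<Rightarrow> ('p, 'i, 'k::field) rep \<Rightarrow> ('p, 'j, 'k) rep
    \<Rightarrow> ('p \<Rightarrow> ('i \<Rightarrow> 'k) \<Rightarrow> 'j \<Rightarrow> 'k) \<Rightarrow> bool" where
  "pisomorphism P M N f \<longleftrightarrow> pmorphism P M N f \<and> (\<forall>a\<in>P. bij_betw (f a) (sp M a) (sp N a))"

definition isomorphic :: "'p::order set \<Rightarrow> ('p, 'i, 'k::field) rep \<Rightarrow> ('p, 'j, 'k) rep \<Rightarrow> bool" where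
  "isomorphic P M N \<longleftrightarrow> (\<exists>f. pisomorphism P M N f)"

definition kernel :: "('p, 'i, 'k::field) rep \<Rightarrow> ('p \<Rightarrow> ('i \<Rightarrow> 'k) \<Rightarrow> 'j \<Rightarrow> 'k)
    \<Rightarrow> ('p, 'i, 'k) rep" where
  "kernel X f = \<lparr>sp = (\<lambda>a. {x \<in> sp X a. f a x = 0}), tr = tr X\<rparr>"

text \<open>
  The external direct sum of \<open>N 0, \<dots>, N (n - 1)\<close>: an element of \<open>nat \<times> 'i \<Rightarrow> 'k\<close> is a family
  of elements of \<open>'i \<Rightarrow> 'k\<close>, its \<open>i\<close>-th member being \<open>\<lambda>j. x (i, j)\<close>.
\<close>

definition direct_sum :: "nat \<Rightarrow> (nat \<Rightarrow> ('p, 'i, 'k::field) rep) \<Rightarrow> ('p, nat \<times> 'i, 'k) rep" where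
  "direct_sum n N = \<lparr>
     sp = (\<lambda>a. {x. (\<forall>i<n. (\<lambda>j. x (i, j)) \<in> sp (N i) a) \<and> (\<forall>i\<ge>n. \<forall>j. x (i, j) = 0)}),
     tr = (\<lambda>a b x (i, j). if i < n then tr (N i) a b (\<lambda>j. x (i, j)) j else 0)\<rparr>"


text \<open>The module \<open>k\<^sub>I\<close>; the one-dimensional space \<open>k\<close> is \<open>unit \<Rightarrow> 'k\<close>.\<close>

definition kI :: "'p::order set \<Rightarrow> ('p, unit, 'k::field) rep" where
  "kI I = \<lparr>sp = (\<lambda>a. if a \<in> I then UNIV else {0}),
           tr = (\<lambda>a b x. if a \<in> I \<and> b \<in> I then x else 0)\<rparr>"

definition interval_module :: "'p::order set \<Rightarrow> ('p, 'i, 'k::field) rep \<Rightarrow> bool" where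
  "interval_module P M \<longleftrightarrow>
     pmodule P M \<and> (\<exists>I. interval P I \<and> isomorphic P M (kI I :: ('p, unit, 'k) rep))"

definition interval_decomposable :: "'p::order set \<Rightarrow> ('p, nat, 'k::field) rep \<Rightarrow> bool" where
  "interval_decomposable P M \<longleftrightarrow> pmodule P M \<and>
     (\<exists>n (N :: nat \<Rightarrow> ('p, nat, 'k) rep).
        (\<forall>i<n. interval_module P (N i)) \<and> isomorphic P M (direct_sum n N))"

definition interval_cover :: "'p::order set \<Rightarrow> ('p, nat, 'k::field) rep \<Rightarrow> ('p, nat, 'k) rep
    \<Rightarrow> ('p \<Rightarrow> (nat \<Rightarrow> 'k) \<Rightarrow> nat \<Rightarrow> 'k) \<Rightarrow> bool" where
  "interval_cover P M X f \<longleftrightarrow>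
     interval_decomposable P X \<and> pmorphism P X M f \<and>
     (\<forall>Y h. interval_decomposable P Y \<and> pmorphism P Y M h \<longrightarrow>
        (\<exists>g. pmorphism P Y X g \<and> (\<forall>a\<in>P. \<forall>y\<in>sp Y a. f a (g a y) = h a y))) \<and>
     (\<forall>g. pmorphism P X X g \<and> (\<forall>a\<in>P. \<forall>x\<in>sp X a. f a (g a x) = f a x) \<longrightarrow>
        pisomorphism P X X g)"

text \<open>
  Interval covers, and hence the modules \<open>\<Omega>\<^sup>i(M)\<close>, are only determined up to isomorphism:
  \<open>syzygy P M i N\<close> says that \<open>N\<close> is \<open>\<Omega>\<^sup>i(M)\<close> for some choice of successive interval covers.
\<close>

inductive syzygy :: "'p::order set \<Rightarrow> ('p, nat, 'k::field) rep \<Rightarrow> nat \<Rightarrow> ('p, nat, 'k) rep \<Rightarrow> bool"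
  for P M where
  syzygy_0: "syzygy P M 0 M"
| syzygy_Suc: "syzygy P M i N \<Longrightarrow> interval_cover P N X f \<Longrightarrow> syzygy P M (Suc i) (kernel X f)"

text \<open>The infimum of the empty set in \<open>enat\<close> is \<open>\<infinity>\<close>.\<close>

definition int_res_dim :: "'p::order set \<Rightarrow> ('p, nat, 'k::field) rep \<Rightarrow> enat" where
  "int_res_dim P M = Inf {enat m | m. \<exists>N. syzygy P M (Suc m) N \<and> zero_module P N}"

definition int_res_gldim :: "'k::field itself \<Rightarrow> 'p::order set \<Rightarrow> enat" where
  "int_res_gldim k P = Sup {int_res_dim P M | M :: ('p, nat, 'k) rep. pmodule P M}"

end

theory Submission
  imports Defs
begin

text \<open>
  Call a \<open>k[P]\<close>-module torsion-free (with respect to \<open>Q\<close>) if none of its nonzero elements is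
  killed by all maps into the elements of \<open>Q\<close>.  Three facts carry the proof.  First, if \<open>N\<close> is
  torsion-free, then every morphism \<open>k\<^sub>I \<rightarrow> N|\<^sub>Q\<close>, with \<open>I\<close> an interval of \<open>Q\<close>, extends
  uniquely to a morphism from \<open>k\<^sub>H\<close>, with \<open>H\<close> the convex hull of \<open>I\<close> in \<open>P\<close>; hence the
  interval cover of \<open>N\<close> restricts to an approximation over \<open>Q\<close>.  Second, interval covers are injective
  on each interval summand, so the cover and the syzygy of a torsion-free module are torsion-free.
  Third, every \<open>k[Q]\<close>-module is a retract of the restriction of a torsion-free module, namely its
  coinduction.  Minimality of covers over \<open>Q\<close> lifts retractions to syzygies, so the syzygies of \<open>M\<close>
  stay retracts of the restricted syzygies of the coinduced module and vanish whenever these do.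
\<close>

section \<open>Linear maps and modules\<close>

text \<open>Restriction to \<open>Q\<close> need not send interval modules to interval modules,
  since \<open>I \<inter> Q\<close> may be disconnected, nor approximations to approximations. A
  morphism from k_I to the restriction of \<open>N\<close> proposes, at a point \<open>p\<close> of
  the hull outside \<open>Q\<close>, one value for each point of \<open>I\<close> below
  \<open>p\<close>, and these values may differ. Their images at the points of \<open>Q\<close>
  above \<open>p\<close> do agree, so the differences are torsion: this is the origin of the
  torsion-free condition. It is inherited by submodules, hence by kernels, and it holds for
  coinduced modules, whose elements are families indexed by points of \<open>Q\<close>. Syzygies
  over \<open>Q\<close> therefore match those over \<open>P\<close> only up to direct summands, and
  the induction runs over retracts instead of isomorphisms. Covers over \<open>P\<close> come with
  the given resolution, whereas covers over \<open>Q\<close> have to be constructed; the matrix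
  argument for morphisms between interval modules serves this construction.\<close>

lemma fd_subspace_subspace: "fd_subspace S \<Longrightarrow> fspace.subspace S"
  by (auto simp: fd_subspace_def)

lemma fd_subspace_subset:
  assumes "fspace.subspace S" "S \<subseteq> T" "fd_subspace T"
  shows "fd_subspace S"
proof -
  obtain B where B: "finite B" "T = fspace.span B"
    using assms(3) by (auto simp: fd_subspace_def)
  obtain C where C: "C \<subseteq> S" "fspace.independent C" "S \<subseteq> fspace.span C"
    using fspace.maximal_independent_subset by blast
  have "finite C"
    using fspace.independent_span_bound[OF B(1) C(2)] C(1) assms(2) B(2) by blast
  moreover have "fspace.span C = S"
    using fspace.span_subspace[OF C(1,3) assms(1)] .
  ultimately show ?thesis by (auto simp: fd_subspace_def)
qed

text \<open>The target is any \<open>ab_group_add\<close>, so that both linear maps with values in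
  functions and the scalar coordinates of a decomposition are covered.\<close>

lemma additive_on_sum:
  fixes h :: "('i \<Rightarrow> 'k::field) \<Rightarrow> 'b::ab_group_add"
  assumes S: "fspace.subspace S" and h: "\<And>x y. x \<in> S \<Longrightarrow> y \<in> S \<Longrightarrow> h (x + y) = h x + h y"
    and v: "\<And>i. i \<in> A \<Longrightarrow> v i \<in> S"
  shows "h (\<Sum>i\<in>A. v i) = (\<Sum>i\<in>A. h (v i))"
proof -
  have 0: "h 0 = 0" using h[of 0 0] S by (simp add: fspace.subspace_0)
  show ?thesis
    using v
    by (induction A rule: infinite_finite_induct) (auto simp: 0 h S fspace.subspace_sum)
qed

lemma lin_mapD:
  assumes "lin_map S T f" "x \<in> S"
  shows "f x \<in> T" "y \<in> S \<Longrightarrow> f (x + y) = f x + f y" "f (fscale c x) = fscale c (f x)"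
  using assms by (auto simp: lin_map_def)

lemma lin_map_zero: "lin_map S T f \<Longrightarrow> fspace.subspace S \<Longrightarrow> f 0 = 0"
  using lin_mapD(2)[of S T f 0 0] by (simp add: fspace.subspace_0)

lemma lin_map_sum:
  assumes "lin_map S T f" "fspace.subspace S" "\<And>i. i \<in> A \<Longrightarrow> v i \<in> S"
  shows "f (\<Sum>i\<in>A. v i) = (\<Sum>i\<in>A. f (v i))"
  using additive_on_sum[of S f A v] assms lin_mapD(2) by blast

lemma lin_map_diff:
  assumes "lin_map S T f" "fspace.subspace S" "x \<in> S" "y \<in> S"
  shows "f (x - y) = f x - f y"
  using lin_mapD(2)[OF assms(1), of "x - y" y] assms fspace.subspace_diff by fastforce

lemma pmodule_subspace: "pmodule P M \<Longrightarrow> a \<in> P \<Longrightarrow> fspace.subspace (sp M a)"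
  by (auto simp: pmodule_def fd_subspace_subspace)

lemma pmodule_lin_map:
  "pmodule P M \<Longrightarrow> a \<in> P \<Longrightarrow> b \<in> P \<Longrightarrow> a \<le> b \<Longrightarrow> lin_map (sp M a) (sp M b) (tr M a b)"
  by (auto simp: pmodule_def)

lemma pmodule_tr_id: "pmodule P M \<Longrightarrow> a \<in> P \<Longrightarrow> x \<in> sp M a \<Longrightarrow> tr M a a x = x"
  by (auto simp: pmodule_def)

lemma pmodule_tr_tr:
  "pmodule P M \<Longrightarrow> a \<in> P \<Longrightarrow> b \<in> P \<Longrightarrow> c \<in> P \<Longrightarrow> a \<le> b \<Longrightarrow> b \<le> c \<Longrightarrow> x \<in> sp M a
    \<Longrightarrow> tr M b c (tr M a b x) = tr M a c x"
  by (auto simp: pmodule_def)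

lemma pmorphism_lin_map: "pmorphism P M N f \<Longrightarrow> a \<in> P \<Longrightarrow> lin_map (sp M a) (sp N a) (f a)"
  by (auto simp: pmorphism_def)

lemma pmorphism_tr:
  "pmorphism P M N f \<Longrightarrow> a \<in> P \<Longrightarrow> b \<in> P \<Longrightarrow> a \<le> b \<Longrightarrow> x \<in> sp M a
    \<Longrightarrow> f b (tr M a b x) = tr N a b (f a x)"
  by (auto simp: pmorphism_def)

text \<open>Restriction to a full subposet keeps the record as it is; only the set over which the
  conditions range shrinks. Hence there is no separate restriction functor.\<close>

lemma pmodule_subset: "pmodule P M \<Longrightarrow> Q \<subseteq> P \<Longrightarrow> pmodule Q M"
  unfolding pmodule_def by (meson subsetD)

lemma pmorphism_subset: "pmorphism P M N f \<Longrightarrow> Q \<subseteq> P \<Longrightarrow> pmorphism Q M N f"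
  unfolding pmorphism_def by (meson subsetD)

lemma pmorphism_id: "pmorphism P M M (\<lambda>a x. x)"
  by (auto simp: pmorphism_def lin_map_def)

lemma pmorphism_comp:
  assumes "pmorphism P L M f" "pmorphism P M N g"
  shows "pmorphism P L N (\<lambda>a x. g a (f a x))"
  using assms by (auto simp: pmorphism_def lin_map_def image_subset_iff)

lemma pmorphism_sum:
  assumes N: "pmodule P N" and f: "\<And>i. i \<in> A \<Longrightarrow> pmorphism P M N (f i)"
  shows "pmorphism P M N (\<lambda>a x. \<Sum>i\<in>A. f i a x)"
proof -
  have "lin_map (sp M a) (sp N a) (\<lambda>x. \<Sum>i\<in>A. f i a x)" if a: "a \<in> P" for a
    using lin_mapD[OF pmorphism_lin_map[OF f a]] pmodule_subspace[OF N a]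
    unfolding lin_map_def
    by (auto simp: fspace.subspace_sum sum.distrib[symmetric] fspace.scale_sum_right intro!: sum.cong)
  moreover have "(\<Sum>i\<in>A. f i b (tr M a b x)) = tr N a b (\<Sum>i\<in>A. f i a x)"
    if "a \<in> P" "b \<in> P" "a \<le> b" "x \<in> sp M a" for a b x
  proof -
    have "tr N a b (\<Sum>i\<in>A. f i a x) = (\<Sum>i\<in>A. tr N a b (f i a x))"
      using that lin_mapD(1)[OF pmorphism_lin_map[OF f]]
      by (intro lin_map_sum[OF pmodule_lin_map[OF N] pmodule_subspace[OF N]]) auto
    then show ?thesis using that pmorphism_tr[OF f] by (auto intro!: sum.cong)
  qed
  ultimately show ?thesis by (auto simp: pmorphism_def)
qed

lemma pmorphism_diff:
  assumes N: "pmodule P N" and f: "pmorphism P M N f" and g: "pmorphism P M N g"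
  shows "pmorphism P M N (\<lambda>a x. f a x - g a x)"
proof -
  have "lin_map (sp M a) (sp N a) (\<lambda>x. f a x - g a x)" if a: "a \<in> P" for a
    using lin_mapD[OF pmorphism_lin_map[OF f a]] lin_mapD[OF pmorphism_lin_map[OF g a]]
      pmodule_subspace[OF N a]
    unfolding lin_map_def
    by (auto simp: fspace.subspace_diff fspace.scale_right_diff_distrib)
  moreover have "f b (tr M a b x) - g b (tr M a b x) = tr N a b (f a x - g a x)"
    if "a \<in> P" "b \<in> P" "a \<le> b" "x \<in> sp M a" for a b x
    using that lin_map_diff[OF pmodule_lin_map[OF N] pmodule_subspace[OF N]]
      lin_mapD(1)[OF pmorphism_lin_map[OF f]] lin_mapD(1)[OF pmorphism_lin_map[OF g]]
      pmorphism_tr[OF f] pmorphism_tr[OF g] by auto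
  ultimately show ?thesis by (auto simp: pmorphism_def)
qed

lemma pisomorphism_inverse:
  assumes M: "pmodule P M" and f: "pisomorphism P M N f"
  shows "pisomorphism P N M (\<lambda>a. inv_into (sp M a) (f a))"
proof -
  have fm: "pmorphism P M N f" and bij: "\<And>a. a \<in> P \<Longrightarrow> bij_betw (f a) (sp M a) (sp N a)"
    using f by (auto simp: pisomorphism_def)
  let ?g = "\<lambda>a. inv_into (sp M a) (f a)"
  have gin: "?g a y \<in> sp M a" and fg: "f a (?g a y) = y" if "a \<in> P" "y \<in> sp N a" for a y
    using bij[OF that(1)] that(2)
    by (auto simp: bij_betw_def inv_into_into f_inv_into_f)
  have gf: "?g a (f a x) = x" if "a \<in> P" "x \<in> sp M a" for a x
    using bij[OF that(1)] that(2) by (auto simp: bij_betw_def)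
  have "lin_map (sp N a) (sp M a) (?g a)" if a: "a \<in> P" for a
  proof -
    note L = pmorphism_lin_map[OF fm a] and S = pmodule_subspace[OF M a]
    have "?g a (x + y) = ?g a x + ?g a y" if "x \<in> sp N a" "y \<in> sp N a" for x y
      using gf[OF a, of "?g a x + ?g a y"] lin_mapD(2)[OF L, of "?g a x" "?g a y"]
        that gin[OF a] fg[OF a] fspace.subspace_add[OF S] by auto
    moreover have "?g a (fscale c x) = fscale c (?g a x)" if "x \<in> sp N a" for c x
      using gf[OF a, of "fscale c (?g a x)"] lin_mapD(3)[OF L, of "?g a x" c]
        that gin[OF a] fg[OF a] fspace.subspace_scale[OF S] by auto
    ultimately show ?thesis using gin[OF a] by (auto simp: lin_map_def)
  qed
  moreover have "?g b (tr N a b y) = tr M a b (?g a y)"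
    if "a \<in> P" "b \<in> P" "a \<le> b" "y \<in> sp N a" for a b y
    using gf[of b "tr M a b (?g a y)"] pmorphism_tr[OF fm that(1-3), of "?g a y"]
      that gin fg lin_mapD(1)[OF pmodule_lin_map[OF M that(1-3)]] by auto
  moreover have "bij_betw (?g a) (sp N a) (sp M a)" if "a \<in> P" for a
    using bij_betw_inv_into[OF bij[OF that]] .
  ultimately show ?thesis by (auto simp: pisomorphism_def pmorphism_def)
qed

lemma kernel_pmodule:
  assumes X: "pmodule P X" and M: "pmodule P M" and f: "pmorphism P X M f"
  shows "pmodule P (kernel X f)"
proof -
  have "fd_subspace {x \<in> sp X a. f a x = 0}" if a: "a \<in> P" for a
  proof (rule fd_subspace_subset)
    note L = pmorphism_lin_map[OF f a] and S = pmodule_subspace[OF X a]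
    show "fspace.subspace {x \<in> sp X a. f a x = 0}"
      using lin_mapD[OF L] lin_map_zero[OF L S] S
      by (auto simp: fspace.subspace_def)
    show "fd_subspace (sp X a)" using X a by (auto simp: pmodule_def)
  qed auto
  moreover have "f b (tr X a b x) = 0" if "a \<in> P" "b \<in> P" "a \<le> b" "x \<in> sp X a" "f a x = 0" for a b x
    using pmorphism_tr[OF f that(1-4)] that(5)
      lin_map_zero[OF pmodule_lin_map[OF M that(1-3)] pmodule_subspace[OF M that(1)]] by simp
  ultimately show ?thesis
    using X by (auto simp: pmodule_def kernel_def lin_map_def image_subset_iff)
qed

section \<open>Interval-decomposable modules in coordinates\<close>

text \<open>A morphism \<open>k\<^sub>I \<rightarrow> M\<close>, encoded by the images \<open>v a\<close> of \<open>1\<close>.\<close>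

definition kI_hom :: "'p::order set \<Rightarrow> 'p set \<Rightarrow> ('p, 'i, 'k::field) rep \<Rightarrow> ('p \<Rightarrow> 'i \<Rightarrow> 'k) \<Rightarrow> bool" where
  "kI_hom P I M v \<longleftrightarrow> (\<forall>a\<in>P. v a \<in> sp M a) \<and> (\<forall>a\<in>P. a \<notin> I \<longrightarrow> v a = 0)
     \<and> (\<forall>a\<in>P. \<forall>b\<in>P. a \<in> I \<and> a \<le> b \<longrightarrow> tr M a b (v a) = v b)"

lemma kI_homD:
  assumes "kI_hom P I M v" "a \<in> P"
  shows "v a \<in> sp M a" "a \<notin> I \<Longrightarrow> v a = 0"
    "b \<in> P \<Longrightarrow> a \<in> I \<Longrightarrow> a \<le> b \<Longrightarrow> tr M a b (v a) = v b"
  using assms by (auto simp: kI_hom_def)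

lemma kI_hom_pmorphism:
  assumes "kI_hom P I M v" "pmorphism P M N f" "pmodule P M"
  shows "kI_hom P I N (\<lambda>a. f a (v a))"
  using lin_mapD(1)[OF pmorphism_lin_map[OF assms(2)]] pmorphism_tr[OF assms(2), symmetric]
    lin_map_zero[OF pmorphism_lin_map[OF assms(2)] pmodule_subspace[OF assms(3)]] assms(1)
  by (auto simp: kI_hom_def)

lemma kI_hom_diff:
  assumes "kI_hom P I M v" "kI_hom P I M w" "pmodule P M"
  shows "kI_hom P I M (\<lambda>a. v a - w a)"
  using assms(1,2) lin_map_diff[OF pmodule_lin_map[OF assms(3)] pmodule_subspace[OF assms(3)]]
    fspace.subspace_diff[OF pmodule_subspace[OF assms(3)]]
  by (auto simp: kI_hom_def)

lemma kI_hom_scale: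
  assumes "kI_hom P I M v" "pmodule P M"
  shows "kI_hom P I M (\<lambda>a. fscale c (v a))"
  using assms(1) lin_mapD(3)[OF pmodule_lin_map[OF assms(2)]]
    fspace.subspace_scale[OF pmodule_subspace[OF assms(2)]]
  by (auto simp: kI_hom_def)

text \<open>The summands \<open>k\<^bsub>I i\<^esub>\<close> of \<open>X\<close> are given by their inclusions \<open>e i\<close> and projections \<open>c i\<close>;
  in particular \<open>e i a\<close>, for \<open>a \<in> I i\<close>, is a basis of \<open>X\<close> at \<open>a\<close>.\<close>

definition decomp :: "'p::order set \<Rightarrow> ('p, 'i, 'k::field) rep \<Rightarrow> 's set \<Rightarrow> ('s \<Rightarrow> 'p set)
    \<Rightarrow> ('s \<Rightarrow> 'p \<Rightarrow> 'i \<Rightarrow> 'k) \<Rightarrow> ('s \<Rightarrow> 'p \<Rightarrow> ('i \<Rightarrow> 'k) \<Rightarrow> 'k) \<Rightarrow> bool" where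
  "decomp P X A I e c \<longleftrightarrow> finite A \<and> (\<forall>i\<in>A. interval P (I i)) \<and> (\<forall>i\<in>A. kI_hom P (I i) X (e i)) \<and>
     (\<forall>a\<in>P. \<forall>x\<in>sp X a. (\<Sum>i\<in>A. fscale (c i a x) (e i a)) = x) \<and>
     (\<forall>i\<in>A. \<forall>a\<in>P. \<forall>x\<in>sp X a. \<forall>y\<in>sp X a. c i a (x + y) = c i a x + c i a y) \<and>
     (\<forall>i\<in>A. \<forall>a\<in>P. \<forall>x\<in>sp X a. \<forall>s. c i a (fscale s x) = s * c i a x) \<and>
     (\<forall>i\<in>A. \<forall>j\<in>A. \<forall>a\<in>P. a \<in> I j \<longrightarrow> c i a (e j a) = (if i = j then 1 else 0)) \<and>
     (\<forall>i\<in>A. \<forall>a\<in>P. \<forall>x\<in>sp X a. a \<notin> I i \<longrightarrow> c i a x = 0) \<and>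
     (\<forall>i\<in>A. \<forall>a\<in>P. \<forall>b\<in>P. \<forall>x\<in>sp X a. a \<le> b \<longrightarrow> c i b (tr X a b x) = (if b \<in> I i then c i a x else 0))"

lemma decomp_finite: "decomp P X A I e c \<Longrightarrow> finite A"
  by (simp add: decomp_def)

lemma decompD:
  assumes "decomp P X A I e c" "i \<in> A"
  shows "interval P (I i)" "kI_hom P (I i) X (e i)"
    "a \<in> P \<Longrightarrow> x \<in> sp X a \<Longrightarrow> y \<in> sp X a \<Longrightarrow> c i a (x + y) = c i a x + c i a y"
    "a \<in> P \<Longrightarrow> x \<in> sp X a \<Longrightarrow> c i a (fscale s x) = s * c i a x"
    "a \<in> P \<Longrightarrow> j \<in> A \<Longrightarrow> a \<in> I j \<Longrightarrow> c i a (e j a) = (if i = j then 1 else 0)"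
    "a \<in> P \<Longrightarrow> x \<in> sp X a \<Longrightarrow> a \<notin> I i \<Longrightarrow> c i a x = 0"
    "a \<in> P \<Longrightarrow> b \<in> P \<Longrightarrow> a \<le> b \<Longrightarrow> x \<in> sp X a \<Longrightarrow> c i b (tr X a b x) = (if b \<in> I i then c i a x else 0)"
  using assms by (simp_all add: decomp_def)

lemma decomp_expand:
  "decomp P X A I e c \<Longrightarrow> a \<in> P \<Longrightarrow> x \<in> sp X a \<Longrightarrow> (\<Sum>i\<in>A. fscale (c i a x) (e i a)) = x"
  by (simp add: decomp_def)

lemma decomp_sum:
  assumes "decomp P X A I e c" "pmodule P X" "i \<in> A" "a \<in> P" "\<And>j. j \<in> B \<Longrightarrow> v j \<in> sp X a"
  shows "c i a (\<Sum>j\<in>B. v j) = (\<Sum>j\<in>B. c i a (v j))"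
  by (rule additive_on_sum[where h = "c i a" and v = v, OF pmodule_subspace[OF assms(2,4)] decompD(3)[OF assms(1,3,4)] assms(5)])

lemma decomp_diff:
  assumes "decomp P X A I e c" "pmodule P X" "i \<in> A" "a \<in> P" "x \<in> sp X a" "y \<in> sp X a"
  shows "c i a (x - y) = c i a x - c i a y"
  using decompD(3)[OF assms(1,3,4), of "x - y" y] assms
    fspace.subspace_diff[OF pmodule_subspace[OF assms(2,4)]] by fastforce

lemma decomp_zero:
  assumes "decomp P X A I e c" "pmodule P X" "i \<in> A" "a \<in> P"
  shows "c i a 0 = 0"
  using decomp_sum[OF assms, of "{}"] by simp

lemma decomp_basis:
  assumes "decomp P X A I e c" "pmodule P X" "i \<in> A" "j \<in> A" "a \<in> P"
  shows "c i a (e j a) = (if i = j \<and> a \<in> I j then 1 else 0)"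
  using decompD(5)[OF assms(1,3,5,4)] kI_homD(2)[OF decompD(2)[OF assms(1,4)] assms(5)]
    decomp_zero[OF assms(1-3,5)] by (cases "a \<in> I j") auto

text \<open>This is the projection of \<open>X\<close> onto its summand \<open>i\<close>, followed
  by the morphism out of that summand which \<open>w\<close> encodes.\<close>

lemma coord_pmorphism:
  assumes X: "decomp P X A I e c" and i: "i \<in> A" and N: "pmodule P N" and w: "kI_hom P (I i) N w"
  shows "pmorphism P X N (\<lambda>a x. fscale (c i a x) (w a))"
proof -
  note D = decompD[OF X i]
  have "lin_map (sp X a) (sp N a) (\<lambda>x. fscale (c i a x) (w a))" if a: "a \<in> P" for a
    using D(3,4)[OF a] kI_homD(1)[OF w a] fspace.subspace_scale[OF pmodule_subspace[OF N a]]
    by (auto simp: lin_map_def fspace.scale_left_distrib)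
  moreover have "fscale (c i b (tr X a b x)) (w b) = tr N a b (fscale (c i a x) (w a))"
    if ab: "a \<in> P" "b \<in> P" "a \<le> b" "x \<in> sp X a" for a b x
  proof (cases "a \<in> I i")
    case True
    then show ?thesis
      using D(7)[OF ab] kI_homD[OF w ab(1)] kI_homD(2)[OF w ab(2)] ab
        lin_mapD(3)[OF pmodule_lin_map[OF N ab(1-3)]] by auto
  next
    case False
    then show ?thesis
      using D(6)[OF ab(1,4)] D(7)[OF ab] lin_map_zero[OF pmodule_lin_map[OF N ab(1-3)] pmodule_subspace[OF N ab(1)]]
      by auto
  qed
  ultimately show ?thesis by (auto simp: pmorphism_def)
qed

text \<open>A morphism out of a direct sum is a family of morphisms out of the summands: each
  \<open>h (e i)\<close> is lifted separately, and the lifts are assembled along the coordinates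
  \<open>c i\<close>.\<close>

lemma lift_pmorphism:
  assumes Y: "decomp P Y A I e c" and YM: "pmodule P Y" and X: "pmodule P X" and M: "pmodule P M"
    and f: "pmorphism P X M f" and h: "pmorphism P Y M h"
    and lift: "\<And>J v. interval P J \<Longrightarrow> kI_hom P J M v \<Longrightarrow> \<exists>w. kI_hom P J X w \<and> (\<forall>a\<in>P. f a (w a) = v a)"
  shows "\<exists>g. pmorphism P Y X g \<and> (\<forall>a\<in>P. \<forall>y\<in>sp Y a. f a (g a y) = h a y)"
proof -
  have "\<forall>i\<in>A. \<exists>w. kI_hom P (I i) X w \<and> (\<forall>a\<in>P. f a (w a) = h a (e i a))"
    using lift[OF decompD(1)[OF Y] kI_hom_pmorphism[OF decompD(2)[OF Y] h YM]] by auto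
  then obtain w where w: "\<And>i. i \<in> A \<Longrightarrow> kI_hom P (I i) X (w i)"
    "\<And>i a. i \<in> A \<Longrightarrow> a \<in> P \<Longrightarrow> f a (w i a) = h a (e i a)"
    by metis
  define g where "g = (\<lambda>a y. \<Sum>i\<in>A. fscale (c i a y) (w i a))"
  have "pmorphism P Y X g"
    unfolding g_def using coord_pmorphism[OF Y _ X] w(1) by (intro pmorphism_sum[OF X]) auto
  moreover have "f a (g a y) = h a y" if a: "a \<in> P" and y: "y \<in> sp Y a" for a y
  proof -
    note F = pmorphism_lin_map[OF f a] and H = pmorphism_lin_map[OF h a]
    have "f a (g a y) = (\<Sum>i\<in>A. f a (fscale (c i a y) (w i a)))"
      unfolding g_def using kI_homD(1)[OF w(1) a] fspace.subspace_scale[OF pmodule_subspace[OF X a]]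
      by (intro lin_map_sum[OF F pmodule_subspace[OF X a]]) auto
    also have "\<dots> = (\<Sum>i\<in>A. fscale (c i a y) (h a (e i a)))"
      using kI_homD(1)[OF w(1) a] lin_mapD(3)[OF F] w(2)[OF _ a] by (intro sum.cong) auto
    also have "\<dots> = (\<Sum>i\<in>A. h a (fscale (c i a y) (e i a)))"
      using kI_homD(1)[OF decompD(2)[OF Y] a] lin_mapD(3)[OF H] by (intro sum.cong) auto
    also have "\<dots> = h a (\<Sum>i\<in>A. fscale (c i a y) (e i a))"
      using kI_homD(1)[OF decompD(2)[OF Y] a] fspace.subspace_scale[OF pmodule_subspace[OF YM a]]
      by (intro lin_map_sum[OF H pmodule_subspace[OF YM a], symmetric]) auto
    finally show ?thesis using decomp_expand[OF Y a y] by simp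
  qed
  ultimately show ?thesis by blast
qed

lemma interval_convexD:
  assumes "interval P I" "x \<in> I" "y \<in> I" "z \<in> P" "x \<le> z" "z \<le> y"
  shows "z \<in> I"
  using assms unfolding interval_def poset_convex_def by (metis le_less)

lemma sum_fun_apply: "(\<Sum>i\<in>A. f i) x = (\<Sum>i\<in>A. f i x)"
  for f :: "'s \<Rightarrow> 'i \<Rightarrow> 'k::comm_monoid_add"
  by (induction A rule: infinite_finite_induct) auto

text \<open>Meant for targets such as \<open>direct_sum\<close> and \<open>kI\<close>, which are
  known only through an isomorphism; it supplies the subspace property that the transport of a
  decomposition uses.\<close>

lemma pisomorphism_subspace:
  assumes X: "pmodule P X" and f: "pisomorphism P X Y f" and a: "a \<in> P"
  shows "fspace.subspace (sp Y a)"
proof -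
  have L: "lin_map (sp X a) (sp Y a) (f a)" and Y: "sp Y a = f a ` sp X a"
    using f a by (auto simp: pisomorphism_def pmorphism_def bij_betw_def)
  note S = pmodule_subspace[OF X a]
  show ?thesis unfolding Y fspace.subspace_def
  proof (safe)
    show "0 \<in> f a ` sp X a"
      using lin_map_zero[OF L S] fspace.subspace_0[OF S] by (metis image_eqI)
    show "f a x + f a y \<in> f a ` sp X a" if "x \<in> sp X a" "y \<in> sp X a" for x y
      using lin_mapD(2)[OF L that] fspace.subspace_add[OF S that] by (metis image_eqI)
    show "fscale c (f a x) \<in> f a ` sp X a" if "x \<in> sp X a" for c x
      using lin_mapD(3)[OF L that, of c] fspace.subspace_scale[OF S that, of c] by (metis image_eqI)
  qed
qed

lemma decomp_transport:
  assumes X: "pmodule P X" and f: "pisomorphism P X Y f" and Y: "decomp P Y A I e c"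
  shows "decomp P X A I (\<lambda>i a. inv_into (sp X a) (f a) (e i a)) (\<lambda>i a x. c i a (f a x))"
proof -
  let ?g = "\<lambda>a. inv_into (sp X a) (f a)"
  have fm: "pmorphism P X Y f" and gm: "pmorphism P Y X ?g"
    and bij: "\<And>a. a \<in> P \<Longrightarrow> bij_betw (f a) (sp X a) (sp Y a)"
    using f pisomorphism_inverse[OF X f] by (auto simp: pisomorphism_def)
  note S = pisomorphism_subspace[OF X f] and L = pmorphism_lin_map[OF fm]
    and LG = pmorphism_lin_map[OF gm]
  have fg: "f a (?g a y) = y" if "a \<in> P" "y \<in> sp Y a" for a y
    using bij[OF that(1)] that(2) by (auto simp: bij_betw_def f_inv_into_f)
  have gf: "?g a (f a x) = x" if "a \<in> P" "x \<in> sp X a" for a x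
    using bij[OF that(1)] that(2) by (auto simp: bij_betw_def)
  note e = kI_homD[OF decompD(2)[OF Y]]
  have 1: "kI_hom P (I i) X (\<lambda>a. ?g a (e i a))" if i: "i \<in> A" for i
    unfolding kI_hom_def
    using e[OF i] lin_mapD(1)[OF LG] lin_map_zero[OF LG S] pmorphism_tr[OF gm, symmetric]
    by auto
  have 2: "(\<Sum>i\<in>A. fscale (c i a (f a x)) (?g a (e i a))) = x" if a: "a \<in> P" and x: "x \<in> sp X a" for a x
  proof -
    have "(\<Sum>i\<in>A. fscale (c i a (f a x)) (?g a (e i a))) = (\<Sum>i\<in>A. ?g a (fscale (c i a (f a x)) (e i a)))"
      using e(1)[OF _ a] lin_mapD(3)[OF LG[OF a]] by (intro sum.cong) auto
    also have "\<dots> = ?g a (\<Sum>i\<in>A. fscale (c i a (f a x)) (e i a))"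
      using e(1)[OF _ a] fspace.subspace_scale[OF S[OF a]]
      by (intro lin_map_sum[OF LG[OF a] S[OF a], symmetric]) auto
    also have "\<dots> = x"
      using decomp_expand[OF Y a lin_mapD(1)[OF L[OF a] x]] gf[OF a x] by simp
    finally show ?thesis .
  qed
  show ?thesis
    unfolding decomp_def
    using 1 2 decompD(1)[OF Y] decomp_finite[OF Y]
    by (auto simp: lin_mapD[OF L] decompD(3-6)[OF Y] fg e(1) decompD(7)[OF Y] pmorphism_tr[OF fm])
qed

lemma kI_decomp:
  assumes I: "interval P I"
  shows "decomp P (kI I) {()} (\<lambda>_. I) (\<lambda>_ a _. if a \<in> I then 1 else 0) (\<lambda>_ a x. x ())"
  using I by (auto simp: decomp_def kI_hom_def kI_def fscale_def fun_eq_iff)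

lemma interval_module_decomp:
  assumes "interval_module P N"
  obtains I u d where "interval P I" "decomp P N {()} (\<lambda>_. I) (\<lambda>_. u) (\<lambda>_. d)"
proof -
  obtain I f where "interval P I" "pisomorphism P N (kI I :: ('a, unit, 'c) rep) f" "pmodule P N"
    using assms by (auto simp: interval_module_def isomorphic_def)
  then show ?thesis using decomp_transport[OF _ _ kI_decomp] that by blast
qed

lemma direct_sum_decomp:
  assumes N: "\<And>i. i < n \<Longrightarrow> pmodule P (N i)"
    and d: "\<And>i. i < n \<Longrightarrow> decomp P (N i) {()} (\<lambda>_. I i) (\<lambda>_. u i) (\<lambda>_. d i)"
  shows "decomp P (direct_sum n N) {..<n} I (\<lambda>i a (i', j). if i' = i then u i a j else 0)
    (\<lambda>i a x. d i a (\<lambda>j. x (i, j)))"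
proof -
  have spD: "(\<lambda>j. x (i, j)) \<in> sp (N i) a" if "x \<in> sp (direct_sum n N) a" "i < n" for x a i
    using that by (auto simp: direct_sum_def)
  have sp0: "x (i, j) = 0" if "x \<in> sp (direct_sum n N) a" "\<not> i < n" for x a i j
    using that by (auto simp: direct_sum_def)
  have plus: "(\<lambda>j. x (i, j) + y (i, j)) = (\<lambda>j. x (i, j)) + (\<lambda>j. y (i, j))"
    and scale: "(\<lambda>j. fscale s x (i, j)) = fscale s (\<lambda>j. x (i, j))"
    for x y :: "nat \<times> 'b \<Rightarrow> 'c" and s i
    by (auto simp: fscale_def)
  note D = decompD[OF d, of _ "()", simplified]
  note u = kI_homD[OF D(2)]
  have 1: "kI_hom P (I i) (direct_sum n N) (\<lambda>a (i', j). if i' = i then u i a j else 0)" if i: "i < n" for i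
  proof -
    have "tr (N k) a b (\<lambda>j. 0) = (\<lambda>j. 0)" if "a \<in> P" "b \<in> P" "a \<le> b" "k < n" for a b k
      using lin_map_zero[OF pmodule_lin_map[OF N[OF that(4)] that(1-3)] pmodule_subspace[OF N[OF that(4)] that(1)]]
      by (simp add: zero_fun_def)
    moreover have "tr (N i) a b (u i a) = u i b" if "a \<in> P" "b \<in> P" "a \<in> I i" "a \<le> b" for a b
      using u(3)[OF i] that by blast
    moreover have "(\<lambda>j. if i' = i then u i a j else 0) \<in> sp (N i') a" if "a \<in> P" "i' < n" for a i'
      using u(1)[OF i] that fspace.subspace_0[OF pmodule_subspace[OF N]]
      by (cases "i' = i") (auto simp: zero_fun_def)
    ultimately show ?thesis
      using u(2)[OF i] i by (auto simp: kI_hom_def direct_sum_def fun_eq_iff[of _ "_ :: nat \<times> _ \<Rightarrow> _"])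
  qed
  have 2: "(\<Sum>i<n. fscale (d i a (\<lambda>j. x (i, j))) (\<lambda>(i', j). if i' = i then u i a j else 0)) = x"
    if a: "a \<in> P" and x: "x \<in> sp (direct_sum n N) a" for a x
  proof
    fix p :: "nat \<times> 'b"
    obtain i j where p: "p = (i, j)" by force
    have "(\<Sum>i<n. fscale (d i a (\<lambda>j. x (i, j))) (\<lambda>(i', j). if i' = i then u i a j else 0)) p
      = (\<Sum>k<n. if k = i then d i a (\<lambda>j. x (i, j)) * u i a j else 0)"
      unfolding sum_fun_apply by (intro sum.cong) (auto simp: p fscale_def)
    also have "\<dots> = (if i < n then fscale (d i a (\<lambda>j. x (i, j))) (u i a) j else 0)"
      by (auto simp: sum.delta fscale_def)
    also have "\<dots> = x p"
      using decomp_expand[OF d a spD[OF x], of i] sp0[OF x] p by (auto simp: fun_eq_iff)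
    finally show "(\<Sum>i<n. fscale (d i a (\<lambda>j. x (i, j))) (\<lambda>(i', j). if i' = i then u i a j else 0)) p = x p" .
  qed
  have 3: "d i a (\<lambda>j'. (\<lambda>(i', j). if i' = k then u k a j else 0) (i, j')) = (if i = k then 1 else 0)"
    if "a \<in> P" "i < n" "k < n" "a \<in> I k" for a i k
    using D(5)[of k a] that decomp_zero[OF d N, of i "()" a]
    by (auto simp: zero_fun_def)
  have tr: "(\<lambda>j. tr (direct_sum n N) a b x (i, j)) = tr (N i) a b (\<lambda>j. x (i, j))" if "i < n" for a b x i
    using that by (auto simp: direct_sum_def)
  show ?thesis
    unfolding decomp_def
    using 1 2 3 D(1) by (auto simp: plus scale tr D(3,4,6,7) spD)
qed

lemma interval_decomposable_decomp:
  fixes X :: "('p::order, nat, 'k::field) rep"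
  assumes "interval_decomposable P X"
  obtains A :: "nat set" and I e c where "decomp P X A I e c"
proof -
  obtain n and N :: "nat \<Rightarrow> ('p, nat, 'k) rep" and f where X: "pmodule P X" and N: "\<And>i. i < n \<Longrightarrow> interval_module P (N i)"
    and f: "pisomorphism P X (direct_sum n N) f"
    using assms by (auto simp: interval_decomposable_def isomorphic_def)
  have "\<forall>i\<in>{..<n}. \<exists>I u d. decomp P (N i) {()} (\<lambda>_. I) (\<lambda>_. u) (\<lambda>_. d)"
    using interval_module_decomp[OF N] by (metis lessThan_iff)
  then obtain I u d where "\<And>i. i < n \<Longrightarrow> decomp P (N i) {()} (\<lambda>_. I i) (\<lambda>_. u i) (\<lambda>_. d i)"
    by (metis lessThan_iff)
  then have "decomp P (direct_sum n N) {..<n} I (\<lambda>i a (i', j). if i' = i then u i a j else 0)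
    (\<lambda>i a x. d i a (\<lambda>j. x (i, j)))"
    using N by (intro direct_sum_decomp) (auto simp: interval_module_def)
  from decomp_transport[OF X f this] show ?thesis using that by blast
qed

section \<open>From coordinates back to interval-decomposable modules\<close>

text \<open>A copy of \<open>kI\<close> on the coordinate \<open>0\<close>: the summands in
  \<open>interval_decomposable\<close> and the test modules in \<open>interval_cover\<close> live in
  \<open>nat \<Rightarrow> 'k\<close>, while \<open>kI\<close> lives in
  \<open>unit \<Rightarrow> 'k\<close>.\<close>

definition kI_nat :: "'p::order set \<Rightarrow> ('p, nat, 'k::field) rep" where
  "kI_nat I = \<lparr>sp = (\<lambda>a. {x. \<forall>j. x j \<noteq> 0 \<longrightarrow> j = 0 \<and> a \<in> I}),
               tr = (\<lambda>a b x. if a \<in> I \<and> b \<in> I then x else 0)\<rparr>"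

lemma kI_nat_pmodule:
  assumes "interval P I"
  shows "pmodule P (kI_nat I :: ('p::order, nat, 'k::field) rep)"
proof -
  have "{x. \<forall>j. x j \<noteq> 0 \<longrightarrow> j = 0} = fspace.span {(\<lambda>j. if j = 0 then 1 else 0) :: nat \<Rightarrow> 'k}"
  proof -
    have "x = fscale (x 0) (\<lambda>j. if j = 0 then 1 else 0)" if "\<forall>j. x j \<noteq> 0 \<longrightarrow> j = 0" for x :: "nat \<Rightarrow> 'k"
      using that by (auto simp: fscale_def fun_eq_iff)
    then show ?thesis by (auto simp: fspace.span_singleton fscale_def split: if_splits)
  qed
  then have "fd_subspace {x :: nat \<Rightarrow> 'k. \<forall>j. x j \<noteq> 0 \<longrightarrow> j = 0}"
    by (auto simp: fd_subspace_def intro: exI[of _ "{_}"])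
  moreover have "fd_subspace {x :: nat \<Rightarrow> 'k. \<forall>j. x j = 0}"
  proof -
    have "{x :: nat \<Rightarrow> 'k. \<forall>j. x j = 0} = fspace.span {}" by (auto simp: fun_eq_iff)
    then show ?thesis unfolding fd_subspace_def by blast
  qed
  ultimately have "fd_subspace (sp (kI_nat I) a :: (nat \<Rightarrow> 'k) set)" for a
    by (cases "a \<in> I") (auto simp: kI_nat_def)
  then have fd: "\<forall>a\<in>P. fd_subspace (sp (kI_nat I) a :: (nat \<Rightarrow> 'k) set)" by blast
  have "tr (kI_nat I) b c (tr (kI_nat I) a b x) = tr (kI_nat I) a c x"
    if "b \<in> P" "a \<le> b" "b \<le> c" for a b c and x :: "nat \<Rightarrow> 'k"
  proof (cases "a \<in> I \<and> c \<in> I")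
    case True
    then have "b \<in> I" using interval_convexD[OF assms _ _ that] by blast
    with True show ?thesis by (simp add: kI_nat_def)
  next
    case False
    then show ?thesis by (auto simp: kI_nat_def)
  qed
  moreover have "tr (kI_nat I) a a x = x" if "x \<in> sp (kI_nat I) a" for a and x :: "nat \<Rightarrow> 'k"
    using that by (auto simp: kI_nat_def fun_eq_iff)
  moreover have "lin_map (sp (kI_nat I) a) (sp (kI_nat I) b) (tr (kI_nat I) a b :: (nat \<Rightarrow> 'k) \<Rightarrow> _)" for a b
    by (auto simp: lin_map_def kI_nat_def fscale_def fun_eq_iff)
  ultimately show ?thesis
    using fd by (simp add: pmodule_def)
qed

lemma kI_nat_interval_module:
  assumes "interval P I"
  shows "interval_module P (kI_nat I :: ('p::order, nat, 'k::field) rep)"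
proof -
  have "pisomorphism P (kI_nat I :: ('p, nat, 'k) rep) (kI I) (\<lambda>a x _. x 0)"
  proof -
    have "bij_betw (\<lambda>x _. x 0) (sp (kI_nat I) a) (sp (kI I) a :: (unit \<Rightarrow> 'k) set)" for a
      by (rule bij_betw_byWitness[where f' = "\<lambda>x j. if j = 0 then x () else 0"])
        (auto simp: kI_def kI_nat_def fun_eq_iff split: if_splits)
    then show ?thesis
      by (auto simp: pisomorphism_def pmorphism_def lin_map_def fscale_def kI_def kI_nat_def fun_eq_iff)
  qed
  then show ?thesis
    using kI_nat_pmodule assms by (auto simp: interval_module_def isomorphic_def)
qed

text \<open>The coordinates are themselves an isomorphism onto a sum of copies of
  \<open>kI_nat\<close>. The numbering \<open>h\<close> of \<open>A\<close> allows index sets of any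
  type, such as the pairs that arise on restriction.\<close>

lemma decomp_interval_decomposable:
  fixes X :: "('p::order, nat, 'k::field) rep"
  assumes X: "pmodule P X" and D: "decomp P X A I e c"
  shows "interval_decomposable P X"
proof -
  obtain h where h: "bij_betw h {..<card A} A"
    using ex_bij_betw_nat_finite[OF decomp_finite[OF D]] by (auto simp: atLeast0LessThan)
  let ?n = "card A" and ?h' = "inv_into {..<card A} h"
  have hA: "h i \<in> A" if "i < ?n" for i using h that by (auto simp: bij_betw_def)
  define N :: "nat \<Rightarrow> ('p, nat, 'k) rep" where "N = (\<lambda>i. kI_nat (I (h i)))"
  define f where "f = (\<lambda>a x (i, j). if i < ?n \<and> j = (0::nat) then c (h i) a x else 0)"
  note D' = decompD[OF D hA]
  have "pmorphism P X (direct_sum ?n N) f"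
    unfolding pmorphism_def lin_map_def f_def direct_sum_def N_def kI_nat_def
    by (auto simp: D'(3,4,7) D'(4)[unfolded fscale_def] fscale_def fun_eq_iff split: if_splits intro: ccontr D'(6))
  moreover have "bij_betw (f a) (sp X a) (sp (direct_sum ?n N) a)" if a: "a \<in> P" for a
  proof (rule bij_betw_byWitness[where f' = "\<lambda>y. \<Sum>s\<in>A. fscale (y (?h' s, 0)) (e s a)"])
    note e = kI_homD[OF decompD(2)[OF D] a]
    let ?g = "\<lambda>y. \<Sum>s\<in>A. fscale (y (?h' s, 0)) (e s a)"
    have h': "?h' s < ?n" "h (?h' s) = s" if "s \<in> A" for s
      using h that by (auto simp: bij_betw_def f_inv_into_f) (metis inv_into_into lessThan_iff)
    show "\<forall>x\<in>sp X a. ?g (f a x) = x"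
      using decomp_expand[OF D a] h' by (auto simp: f_def)
    show "f a ` sp X a \<subseteq> sp (direct_sum ?n N) a"
      using \<open>pmorphism P X (direct_sum ?n N) f\<close> a by (auto simp: pmorphism_def lin_map_def)
    show "?g ` sp (direct_sum ?n N) a \<subseteq> sp X a"
      using e(1) fspace.subspace_sum fspace.subspace_scale pmodule_subspace[OF X a]
      by (auto intro!: fspace.subspace_sum[OF pmodule_subspace[OF X a]]
          fspace.subspace_scale[OF pmodule_subspace[OF X a]])
    show "\<forall>y\<in>sp (direct_sum ?n N) a. f a (?g y) = y"
    proof
      fix y assume y: "y \<in> sp (direct_sum ?n N) a"
      have y0: "y (i, j) = 0" if "\<not> (i < ?n \<and> j = 0 \<and> a \<in> I (h i))" for i j
        using y that by (cases "i < ?n") (auto simp: direct_sum_def N_def kI_nat_def)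
      have "c (h i) a (?g y) = y (i, 0)" if i: "i < ?n" for i
      proof -
        have "c (h i) a (?g y) = (\<Sum>s\<in>A. c (h i) a (fscale (y (?h' s, 0)) (e s a)))"
          using e(1) fspace.subspace_scale[OF pmodule_subspace[OF X a]]
          by (intro decomp_sum[OF D X hA[OF i] a]) auto
        also have "\<dots> = (\<Sum>s\<in>A. if s = h i then y (i, 0) else 0)"
        proof (rule sum.cong)
          \<comment> \<open>For \<open>a\<close> outside \<open>I (h i)\<close> the vector
            \<open>e (h i) a\<close> is zero, which agrees with \<open>y (i, 0) = 0\<close> from
            \<open>y0\<close>.\<close>
          fix s assume s: "s \<in> A"
          have "?h' (h i) = i" using h i by (auto simp: bij_betw_def)
          then show "c (h i) a (fscale (y (?h' s, 0)) (e s a)) = (if s = h i then y (i, 0) else 0)"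
            using decompD(4)[OF D hA[OF i] a e(1)[OF s]] decomp_basis[OF D X hA[OF i] s a] y0[of i 0]
            by auto
        qed simp
        also have "\<dots> = y (i, 0)" using hA[OF i] decomp_finite[OF D] by (simp add: sum.delta)
        finally show ?thesis .
      qed
      then show "f a (?g y) = y"
        using y0 by (auto simp: f_def fun_eq_iff)
    qed
  qed
  ultimately have "isomorphic P X (direct_sum ?n N)"
    by (auto simp: isomorphic_def pisomorphism_def)
  moreover have "interval_module P (N i)" if "i < ?n" for i
    unfolding N_def by (rule kI_nat_interval_module) (rule D'(1)[OF that])
  ultimately show ?thesis using X by (auto simp: interval_decomposable_def)
qed

section \<open>Approximations tested on single interval modules\<close>

text \<open>The approximation half of \<open>interval_cover\<close>, tested only on the modules k_J
  and phrased with vectors. By additivity of Hom this is equivalent to the test on all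
  interval-decomposable modules.\<close>

definition lifts_kI :: "'p::order set \<Rightarrow> ('p, 'i, 'k::field) rep \<Rightarrow> ('p, 'j, 'k) rep
    \<Rightarrow> ('p \<Rightarrow> ('i \<Rightarrow> 'k) \<Rightarrow> 'j \<Rightarrow> 'k) \<Rightarrow> bool" where
  "lifts_kI P X M f \<longleftrightarrow>
     (\<forall>J v. interval P J \<and> kI_hom P J M v \<longrightarrow> (\<exists>w. kI_hom P J X w \<and> (\<forall>a\<in>P. f a (w a) = v a)))"

lemma lift_interval_decomposable:
  fixes Y :: "('p::order, nat, 'k::field) rep"
  assumes Y: "interval_decomposable P Y" and X: "pmodule P X" and M: "pmodule P M"
    and f: "pmorphism P X M f" and h: "pmorphism P Y M h" and lift: "lifts_kI P X M f"
  shows "\<exists>g. pmorphism P Y X g \<and> (\<forall>a\<in>P. \<forall>y\<in>sp Y a. f a (g a y) = h a y)"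
proof -
  obtain A :: "nat set" and I e c where D: "decomp P Y A I e c"
    using interval_decomposable_decomp[OF Y] .
  have "pmodule P Y" using Y by (simp add: interval_decomposable_def)
  then show ?thesis
    using lift by (intro lift_pmorphism[OF D _ X M f h]) (auto simp: lifts_kI_def)
qed

text \<open>The vectors \<open>v\<close> define a morphism out of \<open>kI_nat J\<close>; its lift
  through the cover, evaluated at the generator \<open>u\<close>, is the required
  \<open>w\<close>.\<close>

lemma interval_cover_lifts_kI:
  fixes X :: "('p::order, nat, 'k::field) rep"
  assumes f: "interval_cover P M X f" and M: "pmodule P M"
  shows "lifts_kI P X M f"
  unfolding lifts_kI_def
proof safe
  fix J v assume J: "interval P J" and v: "kI_hom P J M v"
  let ?Y = "kI_nat J :: ('p, nat, 'k) rep"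
  define u :: "'p \<Rightarrow> nat \<Rightarrow> 'k" where "u = (\<lambda>a j. if a \<in> J \<and> j = 0 then 1 else 0)"
  define d :: "unit \<Rightarrow> 'p \<Rightarrow> (nat \<Rightarrow> 'k) \<Rightarrow> 'k" where "d = (\<lambda>_ a x. x 0)"
  have D: "decomp P ?Y {()} (\<lambda>_. J) (\<lambda>_. u) d"
    using J by (auto simp: decomp_def kI_hom_def kI_nat_def fscale_def fun_eq_iff u_def d_def)
  have Y: "pmodule P ?Y" using kI_nat_pmodule[OF J] .
  have "pmorphism P ?Y M (\<lambda>a x. fscale (d () a x) (v a))"
    using coord_pmorphism[OF D _ M v] by simp
  then obtain g where g: "pmorphism P ?Y X g" "\<And>a y. a \<in> P \<Longrightarrow> y \<in> sp ?Y a \<Longrightarrow> f a (g a y) = fscale (d () a y) (v a)"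
    using f decomp_interval_decomposable[OF Y D] unfolding interval_cover_def by blast
  have u: "kI_hom P J ?Y u" using decompD(2)[OF D] by simp
  have "kI_hom P J X (\<lambda>a. g a (u a))"
    using kI_hom_pmorphism[OF u g(1) Y] .
  moreover have "f a (g a (u a)) = v a" if a: "a \<in> P" for a
    using g(2)[OF a kI_homD(1)[OF u a]] kI_homD(2)[OF v a]
    by (cases "a \<in> J") (auto simp: d_def u_def)
  ultimately show "\<exists>w. kI_hom P J X w \<and> (\<forall>a\<in>P. f a (w a) = v a)"
    by (intro exI[of _ "\<lambda>a. g a (u a)"]) auto
qed

section \<open>Restriction to a full subposet\<close>

text \<open>For \<open>a\<close> outside \<open>D\<close> the reflexive closure yields the singleton
  of \<open>a\<close>; this is why \<open>component_subset\<close> assumes \<open>a \<in> D\<close>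
  while \<open>component_refl\<close> does not.\<close>

definition component :: "'p::order set \<Rightarrow> 'p \<Rightarrow> 'p set" where
  "component D a = {b. (a, b) \<in> {(u, v). u \<in> D \<and> v \<in> D \<and> (u \<le> v \<or> v \<le> u)}\<^sup>*}"

lemma component_refl: "a \<in> component D a"
  by (simp add: component_def)

lemma component_subset: "a \<in> D \<Longrightarrow> component D a \<subseteq> D"
  unfolding component_def by (auto elim: rtranclE)

lemma component_closed:
  assumes "a \<in> D" "x \<in> component D a" "y \<in> D" "x \<le> y \<or> y \<le> x"
  shows "y \<in> component D a"
  using assms component_subset[OF assms(1)] unfolding component_def
  by (auto intro: rtrancl.rtrancl_into_rtrancl)

lemma component_eq:
  assumes "b \<in> component D a"
  shows "component D b = component D a"
proof -
  let ?R = "{(u, v). u \<in> D \<and> v \<in> D \<and> (u \<le> v \<or> v \<le> u)}"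
  have "sym (?R\<^sup>*)" by (intro sym_rtrancl) (auto simp: sym_def)
  then have "(b, a) \<in> ?R\<^sup>*" "(a, b) \<in> ?R\<^sup>*" using assms by (auto simp: component_def sym_def)
  then show ?thesis unfolding component_def by (auto intro: rtrancl_trans)
qed

text \<open>Every vertex of a path in \<open>D\<close> that starts at \<open>a\<close> lies in the
  component, so the path already runs inside it; symmetry then joins any two points through
  \<open>a\<close>.\<close>

lemma component_connected:
  assumes a: "a \<in> D"
  shows "poset_connected (component D a)"
proof -
  let ?C = "component D a"
  let ?R = "{(u, v). u \<in> ?C \<and> v \<in> ?C \<and> (u \<le> v \<or> v \<le> u)}"
  have *: "(a, b) \<in> ?R\<^sup>*" if "b \<in> ?C" for b
  proof -
    from that have "(a, b) \<in> {(u, v). u \<in> D \<and> v \<in> D \<and> (u \<le> v \<or> v \<le> u)}\<^sup>*"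
      by (simp add: component_def)
    then show ?thesis
    proof induction
      case (step x y)
      then have "x \<in> ?C" "y \<in> ?C" unfolding component_def by (auto intro: rtrancl.rtrancl_into_rtrancl)
      with step show ?case by (auto intro: rtrancl.rtrancl_into_rtrancl)
    qed simp
  qed
  have "sym (?R\<^sup>*)" by (intro sym_rtrancl) (auto simp: sym_def)
  then show ?thesis
    unfolding poset_connected_def using * by (meson rtrancl_trans symD)
qed

lemma component_interval:
  assumes "D \<subseteq> P" "poset_convex P D" "a \<in> D"
  shows "interval P (component D a)"
proof -
  have "z \<in> component D a" if "x \<in> component D a" "y \<in> component D a" "z \<in> P" "x < z" "z < y" for x y z
  proof -
    have "x \<in> D" "y \<in> D" using that(1,2) component_subset[OF assms(3)] by auto
    then have "z \<in> D" using assms(2) that(3-5) unfolding poset_convex_def by blast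
    then show ?thesis using component_closed[OF assms(3) that(1)] that(4) by (simp add: less_imp_le)
  qed
  then have "poset_convex P (component D a)" unfolding poset_convex_def by (intro ballI impI) (elim conjE)
  moreover have "component D a \<subseteq> P" "component D a \<noteq> {}"
    using component_subset[OF assms(3)] assms(1) component_refl[of a D] by auto
  ultimately show ?thesis
    using component_connected[OF assms(3)] by (simp add: interval_def)
qed

text \<open>The set \<open>I i \<inter> Q\<close> is convex in \<open>Q\<close> but may be
  disconnected, so the summand \<open>i\<close> breaks up into one interval module for each
  component. The same component can come from several \<open>i\<close>, hence the pairs as
  indices.\<close>

lemma decomp_restrict:
  assumes P: "finite P" and QP: "Q \<subseteq> P" and X: "pmodule P X" and D: "decomp P X A I e c"
  obtains e' c' where "decomp Q X (SIGMA i:A. component (I i \<inter> Q) ` (I i \<inter> Q)) snd e' c'"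
proof -
  define K where "K = (\<lambda>i. component (I i \<inter> Q) ` (I i \<inter> Q))"
  define ee where "ee = (\<lambda>i C a. if a \<in> C then e i a else 0)"
  define cc where "cc = (\<lambda>i C a x. if a \<in> C then c i a x else 0)"
  have sub: "C \<subseteq> I i" "C \<subseteq> Q" if "C \<in> K i" for C i
    using that component_subset[of _ "I i \<inter> Q"] by (auto simp: K_def)
  \<comment> \<open>Comparable points of \<open>I i \<inter> Q\<close> share a component, so no
    structure map joins two components; this makes the inclusions \<open>ee\<close> and the
    projections \<open>cc\<close> natural.\<close>
  have up: "b \<in> C" if "C \<in> K i" "a \<in> C" "b \<in> I i" "b \<in> Q" "a \<le> b \<or> b \<le> a" for C i a b
    using that component_closed[of _ "I i \<inter> Q" a b] by (auto simp: K_def)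
  have eqC: "C = component (I i \<inter> Q) a" if "C \<in> K i" "a \<in> C" for C i a
    using that component_eq by (auto simp: K_def)
  have memC: "component (I i \<inter> Q) a \<in> K i" "a \<in> component (I i \<inter> Q) a" if "a \<in> I i" "a \<in> Q" for a i
    using that component_refl by (auto simp: K_def)
  have fin: "finite (K i)" for i
    using finite_subset[OF QP P] by (auto simp: K_def)
  have int: "interval Q C" if i: "i \<in> A" and C: "C \<in> K i" for i C
  proof -
    have "poset_convex Q (I i \<inter> Q)"
      unfolding poset_convex_def
    proof (intro ballI impI)
      fix x y z assume "x \<in> I i \<inter> Q" "y \<in> I i \<inter> Q" "z \<in> Q" "x < z \<and> z < y"
      then show "z \<in> I i \<inter> Q"
        using interval_convexD[OF decompD(1)[OF D i], of x y z] QP by (simp add: less_imp_le subset_iff)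
    qed
    then show ?thesis using C component_interval[of "I i \<inter> Q" Q] unfolding K_def by (elim imageE) simp
  qed
  have S0: "0 \<in> sp X a" if "a \<in> Q" for a
    using pmodule_subspace[OF X] QP that by (auto intro: fspace.subspace_0)
  have hom: "kI_hom Q C X (ee i C)" if i: "i \<in> A" and C: "C \<in> K i" for i C
    unfolding kI_hom_def ee_def
  proof safe
    fix a b assume ab: "a \<in> Q" "b \<in> Q" "a \<in> C" "a \<le> b"
    have "tr X a b (e i a) = e i b"
      using kI_homD(3)[OF decompD(2)[OF D i]] ab QP sub(1)[OF C] by blast
    moreover have "e i b = 0" if "b \<notin> C"
      using kI_homD(2)[OF decompD(2)[OF D i]] up[OF C ab(3) _ ab(2)] ab QP that by blast
    ultimately show "tr X a b (if a \<in> C then e i a else 0) = (if b \<in> C then e i b else 0)"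
      using ab by auto
  qed (use S0 kI_homD(1)[OF decompD(2)[OF D i]] QP in auto)
  have ex: "(\<Sum>(i, C)\<in>Sigma A K. fscale (cc i C a x) (ee i C a)) = x"
    if a: "a \<in> Q" and x: "x \<in> sp X a" for a x
  proof -
    have aP: "a \<in> P" using a QP by blast
    have "(\<Sum>(i, C)\<in>Sigma A K. fscale (cc i C a x) (ee i C a))
      = (\<Sum>i\<in>A. \<Sum>C\<in>K i. fscale (cc i C a x) (ee i C a))"
      using decomp_finite[OF D] fin by (subst sum.Sigma) auto
    also have "\<dots> = (\<Sum>i\<in>A. fscale (c i a x) (e i a))"
    proof (rule sum.cong)
      fix i assume i: "i \<in> A"
      \<comment> \<open>At most one component contains \<open>a\<close>. If none does, then
        \<open>a \<notin> I i\<close> and the coordinate \<open>c i a x\<close> is zero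
        anyway.\<close>
      have "(\<Sum>C\<in>K i. fscale (cc i C a x) (ee i C a))
        = (\<Sum>C\<in>K i. if C = component (I i \<inter> Q) a then fscale (c i a x) (e i a) else 0)"
      proof (rule sum.cong)
        fix C assume C: "C \<in> K i"
        show "fscale (cc i C a x) (ee i C a)
          = (if C = component (I i \<inter> Q) a then fscale (c i a x) (e i a) else 0)"
        proof (cases "a \<in> C")
          case True
          then have "C = component (I i \<inter> Q) a" using eqC[OF C] by blast
          then show ?thesis unfolding cc_def ee_def if_P[OF True] by (rule if_P[symmetric])
        next
          case False
          then have "C \<noteq> component (I i \<inter> Q) a" using component_refl[of a] by metis
          with False show ?thesis by (simp add: cc_def)
        qed
      qed simp
      also have "\<dots> = fscale (c i a x) (e i a)"
        using fin memC[OF _ a, of i] decompD(6)[OF D i aP x] by (cases "a \<in> I i") (auto simp: sum.delta)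
      finally show "(\<Sum>C\<in>K i. fscale (cc i C a x) (ee i C a))
        = fscale (c i a x) (e i a)" .
    qed simp
    also have "\<dots> = x" using decomp_expand[OF D aP x] .
    finally show ?thesis .
  qed
  have delta: "cc i C a (ee j C' a) = (if i = j \<and> C = C' then 1 else 0)"
    if "i \<in> A" "C \<in> K i" "j \<in> A" "C' \<in> K j" "a \<in> Q" "a \<in> C'" for i C j C' a
  proof (cases "a \<in> C")
    case True
    have "C = C'" if "i = j"
      using eqC[OF \<open>C \<in> K i\<close> True] eqC[OF \<open>C' \<in> K j\<close> \<open>a \<in> C'\<close>] that by simp
    moreover have "a \<in> P" "a \<in> I j" using that(5,6) QP sub(1)[OF that(4)] by auto
    ultimately show ?thesis
      using True that(6) decompD(5)[OF D that(1) _ that(3)] by (auto simp: cc_def ee_def)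
  next
    case False
    then show ?thesis using that by (auto simp: cc_def)
  qed
  have tr: "cc i C b (tr X a b x) = (if b \<in> C then cc i C a x else 0)"
    if "i \<in> A" "C \<in> K i" "a \<in> Q" "b \<in> Q" "a \<le> b" "x \<in> sp X a" for i C a b x
  proof -
    have "a \<in> P" "b \<in> P" using that QP by auto
    note c = decompD(6,7)[OF D that(1)]
    show ?thesis
      using c(1)[OF \<open>a \<in> P\<close> that(6)] c(2)[OF \<open>a \<in> P\<close> \<open>b \<in> P\<close> that(5,6)] up[OF that(2), of b a]
        that(3,5) sub(1)[OF that(2)] by (auto simp: cc_def)
  qed
  have fS: "finite (Sigma A K)" using decomp_finite[OF D] fin by auto
  have cP: "a \<in> P" if "a \<in> Q" for a using that QP by auto
  have add: "cc i C a (x + y) = cc i C a x + cc i C a y"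
    and scale: "cc i C a (fscale s x) = s * cc i C a x"
    if "i \<in> A" "a \<in> Q" "x \<in> sp X a" "y \<in> sp X a" for i C a x y s
    using decompD(3,4)[OF D that(1) cP[OF that(2)]] that by (auto simp: cc_def)
  have "cc i C a x = 0" if "a \<notin> C" for i C a x using that by (simp add: cc_def)
  then have "decomp Q X (Sigma A K) snd (\<lambda>(i, C). ee i C) (\<lambda>(i, C). cc i C)"
    unfolding decomp_def Ball_def split_paired_All mem_Sigma_iff prod.case snd_conv
    using fS int hom ex delta tr add scale
    by (auto simp: case_prod_unfold)
  then show thesis using that unfolding K_def by blast
qed

section \<open>Morphisms between interval modules\<close>

text \<open>A morphism \<open>k\<^sub>I \<rightarrow> k\<^sub>J\<close>, encoded by the scalars by which it acts.\<close>

definition kI_kI_hom :: "'p::order set \<Rightarrow> 'p set \<Rightarrow> 'p set \<Rightarrow> ('p \<Rightarrow> 'k::field) \<Rightarrow> bool" where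
  "kI_kI_hom P I J t \<longleftrightarrow> (\<forall>a\<in>P. a \<notin> I \<or> a \<notin> J \<longrightarrow> t a = 0)
     \<and> (\<forall>a\<in>P. \<forall>b\<in>P. a \<in> I \<and> b \<in> J \<and> a \<le> b \<longrightarrow> t a = t b)"

lemma kI_kI_hom_coord:
  assumes D: "decomp P X A I e c" and X: "pmodule P X" and i: "i \<in> A" and w: "kI_hom P J X w"
  shows "kI_kI_hom P J (I i) (\<lambda>a. c i a (w a))"
proof -
  note D' = decompD[OF D i] and w' = kI_homD[OF w]
  have "c i a (w a) = c i b (w b)" if "a \<in> P" "b \<in> P" "a \<in> J" "b \<in> I i" "a \<le> b" for a b
    using D'(7)[OF that(1,2,5) w'(1)[OF that(1)]] w'(3)[OF that(1,2,3,5)] that by auto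
  moreover have "c i a (w a) = 0" if "a \<in> P" "a \<notin> J \<or> a \<notin> I i" for a
    using D'(6)[OF that(1) w'(1)[OF that(1)]] w'(2)[OF that(1)] that(2) decomp_zero[OF D X i that(1)] by auto
  ultimately show ?thesis unfolding kI_kI_hom_def by blast
qed

lemma kI_kI_hom_add:
  "kI_kI_hom P I J s \<Longrightarrow> kI_kI_hom P I J t \<Longrightarrow> kI_kI_hom P I J (\<lambda>a. s a + t a)"
  unfolding kI_kI_hom_def by (metis add.right_neutral)

text \<open>These are the scalars of a composite. If \<open>a\<close> or \<open>b\<close> lies
  outside \<open>J\<close>, both products vanish: the scalar of \<open>t\<close> or \<open>s\<close>
  that is zero there equals the scalar of the same morphism at the other point.\<close>

lemma kI_kI_hom_mult:
  assumes t: "kI_kI_hom P I J t" and s: "kI_kI_hom P J K s"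
  shows "kI_kI_hom P I K (\<lambda>a. s a * t a)"
proof -
  have "s a * t a = s b * t b" if "a \<in> P" "b \<in> P" "a \<in> I" "b \<in> K" "a \<le> b" for a b
    using t s that unfolding kI_kI_hom_def
    by (cases "a \<in> J"; cases "b \<in> J") (metis mult_zero_left mult_zero_right)+
  then show ?thesis
    using t s unfolding kI_kI_hom_def by auto
qed

text \<open>Comparable points of \<open>I\<close> carry the same scalar, and chains of comparable
  points connect \<open>I\<close>. In other words, the endomorphism ring of k_I is
  \<open>k\<close>.\<close>

lemma kI_endo_const:
  assumes t: "kI_kI_hom P I I t" and I: "interval P I" and ab: "a \<in> I" "b \<in> I"
  shows "t a = t b"
proof -
  have "(a, b) \<in> {(u, v). u \<in> I \<and> v \<in> I \<and> (u \<le> v \<or> v \<le> u)}\<^sup>*"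
    using I ab by (auto simp: interval_def poset_connected_def)
  then show ?thesis
  proof induction
    case (step x y)
    then have xy: "x \<in> I" "y \<in> I" "x \<le> y \<or> y \<le> x" by auto
    then have "x \<in> P" "y \<in> P" using I by (auto simp: interval_def)
    with xy have "t x = t y" using t unfolding kI_kI_hom_def by metis
    with step show ?case by simp
  qed simp
qed

text \<open>The product of the scalars is constant on \<open>I\<close> as an endomorphism of k_I,
  and constant on \<open>J\<close> as an endomorphism of k_J. Since \<open>I \<noteq> J\<close>,
  some point lies in exactly one of them, and there the product is zero.\<close>

lemma kI_endo_factor_zero:
  assumes t: "kI_kI_hom P I J t" and s: "kI_kI_hom P J I s"
    and I: "interval P I" and J: "interval P J" and "I \<noteq> J" and a: "a \<in> P"
  shows "s a * t a = 0"
proof (cases "a \<in> I \<and> a \<in> J")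
  case True
  have "\<exists>b. b \<in> P \<and> (b \<in> I \<and> b \<notin> J \<or> b \<in> J \<and> b \<notin> I)"
    using \<open>I \<noteq> J\<close> I J by (auto simp: interval_def)
  then obtain b where b: "b \<in> P" "b \<in> I \<and> b \<notin> J \<or> b \<in> J \<and> b \<notin> I" by blast
  have "s b * t b = 0" using b s unfolding kI_kI_hom_def by auto
  moreover have "s a * t a = s b * t b"
    using b(2) True kI_endo_const[OF kI_kI_hom_mult[OF t s] I, of a b]
      kI_endo_const[OF kI_kI_hom_mult[OF s t] J, of a b] by (auto simp: mult.commute)
  ultimately show ?thesis by simp
next
  case False
  then show ?thesis using t a unfolding kI_kI_hom_def by auto
qed

text \<open>An endomorphism \<open>1 - t\<close> is bijective if \<open>t\<close> has no component between isomorphic summands.  Solving for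
  the unknown with index \<open>l\<close> replaces \<open>t j i\<close> by \<open>t j i + t j l * t l i\<close>, and this preserves the
  hypothesis because an endomorphism of \<open>k\<^sub>I\<close> that factors through \<open>k\<^sub>J\<close> with \<open>J \<noteq> I\<close> is zero.\<close>

lemma kI_elimination:
  fixes t :: "'s \<Rightarrow> 's \<Rightarrow> 'p::order \<Rightarrow> 'k::field"
  assumes "finite S" and "\<And>i. i \<in> S \<Longrightarrow> interval P (I i)" and a: "a \<in> P"
    and "\<And>i j. i \<in> S \<Longrightarrow> j \<in> S \<Longrightarrow> kI_kI_hom P (I i) (I j) (t j i)"
    and "\<And>i j. i \<in> S \<Longrightarrow> j \<in> S \<Longrightarrow> I i = I j \<Longrightarrow> t j i a = 0"
  shows "(\<forall>x. (\<forall>j\<in>S. x j = (\<Sum>i\<in>S. t j i a * x i)) \<longrightarrow> (\<forall>j\<in>S. x j = 0))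
    \<and> (\<forall>y. \<exists>x. \<forall>j\<in>S. x j = y j + (\<Sum>i\<in>S. t j i a * x i))"
  using assms(1,2,4,5)
proof (induction S arbitrary: t rule: finite_induct)
  case empty
  then show ?case by simp
next
  case (insert l S)
  define t' where "t' = (\<lambda>j i b. t j i b + t j l b * t l i b)"
  have hom: "kI_kI_hom P (I i) (I j) (t' j i)" if "i \<in> S" "j \<in> S" for i j
    unfolding t'_def using that insert.prems(2) by (intro kI_kI_hom_add kI_kI_hom_mult[of P _ "I l"]) auto
  have zero: "t' j i a = 0" if "i \<in> S" "j \<in> S" "I i = I j" for i j
  proof (cases "I i = I l")
    case True
    then show ?thesis using that insert.prems(3) by (auto simp: t'_def)
  next
    case False
    have "t j l a * t l i a = 0"
      using that insert.prems(2)[of i l] insert.prems(2)[of l j] insert.prems(1) False a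
      by (intro kI_endo_factor_zero[of P "I i" "I l"]) auto
    then show ?thesis using that insert.prems(3)[of i j] by (auto simp: t'_def)
  qed
  \<comment> \<open>The vanishing diagonal entry lets equation \<open>l\<close> express
    \<open>x l\<close> through the other unknowns without a division.\<close>
  have tll: "t l l a = 0" using insert.prems(3)[of l l] by simp
  have IH: "(\<forall>x. (\<forall>j\<in>S. x j = (\<Sum>i\<in>S. t' j i a * x i)) \<longrightarrow> (\<forall>j\<in>S. x j = 0))"
    "(\<forall>y. \<exists>x. \<forall>j\<in>S. x j = y j + (\<Sum>i\<in>S. t' j i a * x i))"
    using insert.IH[of t'] insert.prems(1) hom zero by auto
  have t': "(\<Sum>i\<in>S. t' j i a * x i) = (\<Sum>i\<in>S. t j i a * x i) + t j l a * (\<Sum>i\<in>S. t l i a * x i)" for j and x :: "'s \<Rightarrow> 'k"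
    by (simp add: t'_def algebra_simps sum.distrib sum_distrib_left)
  have *: "(\<Sum>i\<in>insert l S. t j i a * x i) = t j l a * x l + (\<Sum>i\<in>S. t j i a * x i)" for j and x :: "'s \<Rightarrow> 'k"
    using insert.hyps by simp
  show ?case
  proof (intro conjI allI impI)
    fix x assume x: "\<forall>j\<in>insert l S. x j = (\<Sum>i\<in>insert l S. t j i a * x i)"
    then have xl: "x l = (\<Sum>i\<in>S. t l i a * x i)" using *[of l x] tll by simp
    have "\<forall>j\<in>S. x j = (\<Sum>i\<in>S. t' j i a * x i)"
      using x unfolding * t' xl[symmetric] by simp
    then have "\<forall>j\<in>S. x j = 0" using IH(1) by blast
    then show "\<forall>j\<in>insert l S. x j = 0" using xl by simp
  next
    fix y
    \<comment> \<open>Substituting the expression for \<open>x l\<close> into equation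
      \<open>j\<close> adds \<open>t j l a * y l\<close> to its constant term.\<close>
    obtain x where x: "\<forall>j\<in>S. x j = y j + t j l a * y l + (\<Sum>i\<in>S. t' j i a * x i)"
      using IH(2)[rule_format, of "\<lambda>j. y j + t j l a * y l"] by blast
    define z where "z = x(l := y l + (\<Sum>i\<in>S. t l i a * x i))"
    have zx: "(\<Sum>i\<in>S. t j i a * z i) = (\<Sum>i\<in>S. t j i a * x i)" for j
      using insert.hyps by (intro sum.cong) (auto simp: z_def)
    have "z j = y j + (\<Sum>i\<in>insert l S. t j i a * z i)" if j: "j \<in> insert l S" for j
    proof (cases "j = l")
      case True
      then show ?thesis unfolding * zx using tll by (simp add: z_def)
    next
      case False
      then have "z j = y j + t j l a * y l + (\<Sum>i\<in>S. t' j i a * x i)"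
        using x j by (simp add: z_def)
      then show ?thesis unfolding * zx t' by (simp add: z_def distrib_left)
    qed
    then show "\<exists>x. \<forall>j\<in>insert l S. x j = y j + (\<Sum>i\<in>insert l S. t j i a * x i)" by blast
  qed
qed

section \<open>Existence of interval covers\<close>

lemma kernel_sel [simp]:
  "sp (kernel X f) a = {x \<in> sp X a. f a x = 0}" "tr (kernel X f) = tr X"
  by (simp_all add: kernel_def)

lemma decomp_eqI:
  assumes D: "decomp P X A I e c" and "a \<in> P" "x \<in> sp X a" "y \<in> sp X a"
    and "\<And>i. i \<in> A \<Longrightarrow> c i a x = c i a y"
  shows "x = y"
proof -
  have "(\<Sum>i\<in>A. fscale (c i a x) (e i a)) = (\<Sum>i\<in>A. fscale (c i a y) (e i a))"
    using assms(5) by (intro sum.cong) auto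
  then show ?thesis
    unfolding decomp_expand[OF D assms(2,3)] decomp_expand[OF D assms(2,4)] .
qed

text \<open>The complement of the summand \<open>i\<close> is realised inside \<open>X\<close> as
  the kernel of the idempotent that projects onto this summand, so the remaining vectors and
  coordinates are kept unchanged.\<close>

lemma decomp_remove:
  assumes X: "pmodule P X" and D: "decomp P X A I e c" and i: "i \<in> A"
  defines "X' \<equiv> kernel X (\<lambda>a x. fscale (c i a x) (e i a))"
  shows "pmodule P X'" "decomp P X' (A - {i}) I e c"
    "\<And>a x. a \<in> P \<Longrightarrow> x \<in> sp X' a \<longleftrightarrow> x \<in> sp X a \<and> c i a x = 0"
proof -
  show "pmodule P X'"
    unfolding X'_def by (rule kernel_pmodule[OF X X coord_pmorphism[OF D i X decompD(2)[OF D i]]])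
  show sp: "x \<in> sp X' a \<longleftrightarrow> x \<in> sp X a \<and> c i a x = 0" if a: "a \<in> P" for a x
  proof (cases "x \<in> sp X a \<and> c i a x \<noteq> 0")
    case True
    then have "a \<in> I i" using decompD(6)[OF D i a] by blast
    then have "e i a \<noteq> 0"
      using decompD(5)[OF D i a i] decomp_zero[OF D X i a] by auto
    with True show ?thesis by (auto simp: X'_def)
  next
    case False
    then show ?thesis by (auto simp: X'_def)
  qed
  have "kI_hom P (I j) X' (e j)" if "j \<in> A - {i}" for j
  proof -
    have "e j a \<in> sp X' a" if "a \<in> P" for a
      using sp[OF that] decomp_basis[OF D X i _ that, of j] \<open>j \<in> A - {i}\<close> kI_homD(1)[OF decompD(2)[OF D] that] by auto
    then show ?thesis
      using decompD(2)[OF D, of j] that by (simp add: kI_hom_def X'_def)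
  qed
  moreover have "(\<Sum>j\<in>A - {i}. fscale (c j a x) (e j a)) = x" if "a \<in> P" "x \<in> sp X' a" for a x
    using decomp_expand[OF D that(1), of x] that sp[OF that(1)] i decomp_finite[OF D]
    by (simp add: sum.remove)
  moreover have "x \<in> sp X a" if "x \<in> sp X' a" for a x using that by (simp add: X'_def)
  moreover have "tr X' = tr X" by (simp add: X'_def)
  ultimately show "decomp P X' (A - {i}) I e c"
    using decompD[OF D] decomp_finite[OF D] unfolding decomp_def by simp
qed

text \<open>A summand that contributes to a syzygy \<open>u\<close> of \<open>f\<close> is redundant in the approximation \<open>f\<close>.\<close>

lemma lifts_kI_remove:
  assumes X: "pmodule P X" and D: "decomp P X A I e c" and M: "pmodule P M" and f: "pmorphism P X M f"
    and lift: "lifts_kI P X M f" and i: "i \<in> A"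
    and u: "kI_hom P (I i) X u" and fu: "\<And>a. a \<in> P \<Longrightarrow> f a (u a) = 0"
    and a0: "a0 \<in> P" "c i a0 (u a0) \<noteq> 0"
  shows "lifts_kI P (kernel X (\<lambda>a x. fscale (c i a x) (e i a))) M f"
proof -
  let ?X' = "kernel X (\<lambda>a x. fscale (c i a x) (e i a))"
  define s where "s = c i a0 (u a0)"
  note D' = decompD[OF D i]
  have hom: "kI_kI_hom P (I i) (I i) (\<lambda>a. c i a (u a))"
    by (rule kI_kI_hom_coord[OF D X i u])
  have "a0 \<in> I i" using D'(6)[OF a0(1) kI_homD(1)[OF u a0(1)]] a0(2) by blast
  then have s: "c i a (u a) = s" if "a \<in> I i" for a
    using kI_endo_const[OF hom D'(1) that] by (simp add: s_def)
  \<comment> \<open>The coordinate of \<open>u\<close> at \<open>i\<close> is a single nonzero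
    scalar \<open>s\<close> on all of \<open>I i\<close>, so one division normalises it to
    \<open>1\<close> everywhere on \<open>I i\<close>.\<close>
  define u' where "u' = (\<lambda>a. fscale (1 / s) (u a))"
  have u': "kI_hom P (I i) X u'" unfolding u'_def by (rule kI_hom_scale[OF u X])
  have cu': "c i a (u' a) = 1" if "a \<in> P" "a \<in> I i" for a
    using s[OF that(2)] a0(2) D'(4)[OF that(1) kI_homD(1)[OF u that(1)]] by (simp add: u'_def s_def)
  have fu': "f a (u' a) = 0" if "a \<in> P" for a
    using fu[OF that] lin_mapD(3)[OF pmorphism_lin_map[OF f that] kI_homD(1)[OF u that]]
    by (simp add: u'_def)
  have p: "pmorphism P X X (\<lambda>a x. fscale (c i a x) (u' a))"
    by (rule coord_pmorphism[OF D i X u'])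
  show ?thesis
    unfolding lifts_kI_def
  proof safe
    fix J v assume "interval P J" "kI_hom P J M v"
    then obtain w where w: "kI_hom P J X w" and fw: "\<And>a. a \<in> P \<Longrightarrow> f a (w a) = v a"
      using lift unfolding lifts_kI_def by blast
    \<comment> \<open>The multiple of \<open>u'\<close> cancels the coordinate of \<open>w\<close>
      at \<open>i\<close>; the image under \<open>f\<close> stays the same because \<open>f\<close>
      kills \<open>u'\<close>.\<close>
    define w' where "w' = (\<lambda>a. w a - fscale (c i a (w a)) (u' a))"
    have w': "kI_hom P J X w'"
      unfolding w'_def by (rule kI_hom_diff[OF w kI_hom_pmorphism[OF w p X] X])
    have "w' a \<in> sp ?X' a" if a: "a \<in> P" for a
    proof -
      note wa = kI_homD(1)[OF w a] and ua = kI_homD(1)[OF u' a]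
      have "c i a (w' a) = c i a (w a) - c i a (w a) * c i a (u' a)"
        unfolding w'_def
        using decomp_diff[OF D X i a wa fspace.subspace_scale[OF pmodule_subspace[OF X a] ua]] D'(4)[OF a ua] by simp
      also have "\<dots> = 0"
        using cu'[OF a] D'(6)[OF a wa] by (cases "a \<in> I i") auto
      finally show ?thesis using kI_homD(1)[OF w' a] by simp
    qed
    then have "kI_hom P J ?X' w'" using w' by (simp add: kI_hom_def)
    moreover have "f a (w' a) = v a" if a: "a \<in> P" for a
    proof -
      note S = pmodule_subspace[OF X a] and L = pmorphism_lin_map[OF f a]
      have "f a (w' a) = f a (w a) - f a (fscale (c i a (w a)) (u' a))"
        unfolding w'_def using kI_homD(1)[OF w a] fspace.subspace_scale[OF S kI_homD(1)[OF u' a]]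
        by (intro lin_map_diff[OF L S])
      also have "\<dots> = v a"
        using lin_mapD(3)[OF L kI_homD(1)[OF u' a]] fu'[OF a] fw[OF a] by simp
      finally show ?thesis .
    qed
    ultimately show "\<exists>w. kI_hom P J ?X' w \<and> (\<forall>a\<in>P. f a (w a) = v a)" by blast
  qed
qed

text \<open>The coordinates of the identity minus \<open>g\<close> form a matrix \<open>t\<close> to
  which \<open>kI_elimination\<close> applies at each point: uniqueness of solutions gives
  injectivity of \<open>g\<close>, and existence gives surjectivity.\<close>

lemma endo_bij:
  assumes X: "pmodule P X" and D: "decomp P X A I e c" and g: "pmorphism P X X g"
    and off: "\<And>i j a. i \<in> A \<Longrightarrow> j \<in> A \<Longrightarrow> I i = I j \<Longrightarrow> a \<in> P \<Longrightarrow> c j a (e i a - g a (e i a)) = 0"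
  shows "pisomorphism P X X g"
proof -
  define t where "t = (\<lambda>j i a. c j a (e i a - g a (e i a)))"
  have gg: "pmorphism P X X (\<lambda>a x. x - g a x)"
    by (rule pmorphism_diff[OF X pmorphism_id g])
  have u: "kI_hom P (I i) X (\<lambda>a. e i a - g a (e i a))" if "i \<in> A" for i
    by (rule kI_hom_pmorphism[OF decompD(2)[OF D that] gg X])
  have hom: "kI_kI_hom P (I i) (I j) (t j i)" if "i \<in> A" "j \<in> A" for i j
    unfolding t_def by (rule kI_kI_hom_coord[OF D X that(2) u[OF that(1)]])
  have elim: "(\<forall>x. (\<forall>j\<in>A. x j = (\<Sum>i\<in>A. t j i a * x i)) \<longrightarrow> (\<forall>j\<in>A. x j = 0))"
    "(\<forall>y. \<exists>x. \<forall>j\<in>A. x j = y j + (\<Sum>i\<in>A. t j i a * x i))" if "a \<in> P" for a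
    using kI_elimination[where t = t, OF decomp_finite[OF D] decompD(1)[OF D] that hom] off that
    by (auto simp: t_def)
  have coord: "c j a (g a x) = c j a x - (\<Sum>i\<in>A. t j i a * c i a x)"
    if j: "j \<in> A" and a: "a \<in> P" and x: "x \<in> sp X a" for j a x
  proof -
    note S = pmodule_subspace[OF X a] and L = pmorphism_lin_map[OF gg a]
    note ua = kI_homD(1)[OF u a] and ea = kI_homD(1)[OF decompD(2)[OF D] a]
    have "c j a x - c j a (g a x) = c j a (x - g a x)"
      using decomp_diff[OF D X j a x lin_mapD(1)[OF pmorphism_lin_map[OF g a] x]] by simp
    also have "x - g a x = (\<Sum>i\<in>A. fscale (c i a x) (e i a)) - g a (\<Sum>i\<in>A. fscale (c i a x) (e i a))"
      using decomp_expand[OF D a x] by simp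
    also have "\<dots> = (\<Sum>i\<in>A. fscale (c i a x) (e i a) - g a (fscale (c i a x) (e i a)))"
      using ea fspace.subspace_scale[OF S] by (intro lin_map_sum[OF L S]) auto
    also have "\<dots> = (\<Sum>i\<in>A. fscale (c i a x) (e i a - g a (e i a)))"
      using ea lin_mapD(3)[OF L] by (intro sum.cong) auto
    also have "c j a \<dots> = (\<Sum>i\<in>A. c j a (fscale (c i a x) (e i a - g a (e i a))))"
      using ua fspace.subspace_scale[OF S] by (intro decomp_sum[OF D X j a]) auto
    also have "\<dots> = (\<Sum>i\<in>A. t j i a * c i a x)"
      using decompD(4)[OF D j a ua] by (intro sum.cong) (auto simp: t_def)
    finally show ?thesis by (simp add: algebra_simps)
  qed
  have "bij_betw (g a) (sp X a) (sp X a)" if a: "a \<in> P" for a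
    unfolding bij_betw_def
  proof (intro conjI inj_onI subset_antisym subsetI)
    note S = pmodule_subspace[OF X a] and L = pmorphism_lin_map[OF g a]
    show "x = y" if x: "x \<in> sp X a" and y: "y \<in> sp X a" and xy: "g a x = g a y" for x y
    proof (rule decomp_eqI[OF D a x y])
      have d: "x - y \<in> sp X a" using fspace.subspace_diff[OF S x y] .
      have "g a (x - y) = 0" using lin_map_diff[OF L S x y] xy by simp
      then have "\<forall>j\<in>A. c j a (x - y) = (\<Sum>i\<in>A. t j i a * c i a (x - y))"
        using coord[OF _ a d] decomp_zero[OF D X _ a] by simp
      then have "\<forall>j\<in>A. c j a (x - y) = 0"
        using elim(1)[OF a, rule_format, of "\<lambda>j. c j a (x - y)"] by blast
      then show "c i a x = c i a y" if "i \<in> A" for i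
        using decomp_diff[OF D X that a x y] that by simp
    qed
    show "y \<in> sp X a" if "y \<in> g a ` sp X a" for y
      using that lin_mapD(1)[OF L] by auto
    show "y \<in> g a ` sp X a" if y: "y \<in> sp X a" for y
    proof -
      obtain z where z: "\<forall>j\<in>A. z j = c j a y + (\<Sum>i\<in>A. t j i a * z i)"
        using elim(2)[OF a, rule_format, of "\<lambda>j. c j a y"] by blast
      define x where "x = (\<Sum>i\<in>A. fscale (z i) (e i a))"
      note ea = kI_homD(1)[OF decompD(2)[OF D] a]
      have x: "x \<in> sp X a"
        unfolding x_def using fspace.subspace_scale[OF S] ea by (intro fspace.subspace_sum[OF S]) auto
      \<comment> \<open>The system also has equations for indices \<open>j\<close> with
        \<open>a \<notin> I j\<close>. There \<open>e j a\<close> is zero, so \<open>z j\<close> can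
        be a coordinate of \<open>x\<close> only if it vanishes.\<close>
      have z0: "z j = 0" if "j \<in> A" "a \<notin> I j" for j
        using z that decompD(6)[OF D that(1) a y] hom[OF _ that(1)] a
        by (auto simp: kI_kI_hom_def)
      have cx: "c j a x = z j" if j: "j \<in> A" for j
      proof -
        have "c j a x = (\<Sum>i\<in>A. c j a (fscale (z i) (e i a)))"
          unfolding x_def using fspace.subspace_scale[OF S] ea by (intro decomp_sum[OF D X j a]) auto
        also have "\<dots> = (\<Sum>i\<in>A. if i = j then z j else 0)"
          using decompD(4)[OF D j a ea] decomp_basis[OF D X j _ a] z0 by (intro sum.cong) auto
        also have "\<dots> = z j" using j decomp_finite[OF D] by simp
        finally show ?thesis .
      qed
      have gx: "g a x \<in> sp X a" using lin_mapD(1)[OF L x] .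
      have "g a x = y"
      proof (rule decomp_eqI[OF D a gx y])
        fix j assume j: "j \<in> A"
        have "c j a (g a x) = z j - (\<Sum>i\<in>A. t j i a * z i)"
          using coord[OF j a x] cx j by simp
        then show "c j a (g a x) = c j a y" using z j by (simp add: algebra_simps)
      qed
      then show ?thesis using x by blast
    qed
  qed
  then show ?thesis using g by (simp add: pisomorphism_def)
qed

text \<open>An approximation with the fewest summands is a cover.\<close>

lemma interval_cover_exists:
  fixes M :: "('p::order, nat, 'k::field) rep" and A0 :: "'s set"
  assumes M: "pmodule P M" and X0: "pmodule P X0" and D0: "decomp P X0 A0 I0 e0 c0"
    and f0: "pmorphism P (X0 :: ('p, nat, 'k) rep) M f0" and lift0: "lifts_kI P X0 M f0"
  obtains X f where "interval_cover P M X f"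
proof -
  \<comment> \<open>Removing a summand shrinks the index set, so all competitors can be indexed by
    subsets of one type \<open>'s\<close>.\<close>
  define good where "good = (\<lambda>n. \<exists>(X :: ('p, nat, 'k) rep) f (A :: 's set) I e c. pmodule P X \<and>
    decomp P X A I e c \<and> card A = n \<and> pmorphism P X M f \<and> lifts_kI P X M f)"
  have "good (card A0)"
    unfolding good_def using assms by blast
  then have "good (LEAST n. good n)" by (rule LeastI)
  then obtain X :: "('p, nat, 'k) rep" and f and A :: "'s set" and I e c
    where X: "pmodule P X" and D: "decomp P X A I e c" and card: "card A = (LEAST n. good n)"
      and f: "pmorphism P X M f" and lift: "lifts_kI P X M f"
    unfolding good_def by blast
  have min: "c i a (u a) = 0"
    if i: "i \<in> A" and u: "kI_hom P (I i) X u" and fu: "\<And>a. a \<in> P \<Longrightarrow> f a (u a) = 0" and a: "a \<in> P" for i u a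
  proof (rule ccontr)
    assume "c i a (u a) \<noteq> 0"
    let ?X' = "kernel X (\<lambda>a x. fscale (c i a x) (e i a))"
    have "lifts_kI P ?X' M f"
      by (rule lifts_kI_remove[where u = u and ?a0.0 = a]) (fact X D M f lift i u fu a \<open>c i a (u a) \<noteq> 0\<close>)+
    moreover have "pmorphism P ?X' M f"
      using f by (auto simp: pmorphism_def lin_map_def image_subset_iff)
    ultimately have "good (card (A - {i}))"
      unfolding good_def using decomp_remove(1,2)[OF X D i] by blast
    then have "card A \<le> card (A - {i})" unfolding card by (rule Least_le)
    then show False using card_Diff1_less[OF decomp_finite[OF D] i] by simp
  qed
  have "pisomorphism P X X g"
    if g: "pmorphism P X X g" and fg: "\<And>a x. a \<in> P \<Longrightarrow> x \<in> sp X a \<Longrightarrow> f a (g a x) = f a x" for g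
  proof (rule endo_bij[OF X D g])
    fix i j a assume ij: "i \<in> A" "j \<in> A" "I i = I j" "a \<in> P"
    \<comment> \<open>Since \<open>g\<close> is a morphism over \<open>f\<close>, these vectors lie
      in the kernel of \<open>f\<close>. As \<open>I i = I j\<close>, they also encode a morphism
      out of the summand \<open>j\<close>, so \<open>min\<close> applies at
      \<open>j\<close>.\<close>
    let ?u = "\<lambda>a. e i a - g a (e i a)"
    have "kI_hom P (I j) X ?u"
      using kI_hom_pmorphism[OF decompD(2)[OF D ij(1)] pmorphism_diff[OF X pmorphism_id g] X] ij(3) by simp
    moreover have "f b (?u b) = 0" if b: "b \<in> P" for b
    proof -
      note eb = kI_homD(1)[OF decompD(2)[OF D ij(1)] b]
      show ?thesis
        using lin_map_diff[OF pmorphism_lin_map[OF f b] pmodule_subspace[OF X b] eb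
            lin_mapD(1)[OF pmorphism_lin_map[OF g b] eb]] fg[OF b eb] by simp
    qed
    ultimately show "c j a (?u a) = 0" using min[OF ij(2)] ij(4) by blast
  qed
  moreover have "\<exists>g. pmorphism P Y X g \<and> (\<forall>a\<in>P. \<forall>y\<in>sp Y a. f a (g a y) = h a y)"
    if "interval_decomposable P Y" "pmorphism P Y M h" for Y :: "('p, nat, 'k) rep" and h
    by (rule lift_interval_decomposable[OF that(1) X M f that(2) lift])
  ultimately have "interval_cover P M X f"
    using f decomp_interval_decomposable[OF X D] unfolding interval_cover_def by simp
  then show thesis by (rule that)
qed

section \<open>Torsion-free modules\<close>

text \<open>The support \<open>S\<close> of \<open>f\<close> on the summand \<open>i\<close> is closed downwards in \<open>I i\<close>.  Lifting \<open>f\<close> on the components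
  of \<open>S\<close> yields \<open>w\<close> with \<open>f w = f (e i)\<close>, and replacing \<open>e i\<close> by \<open>w\<close> defines an endomorphism over \<open>f\<close>
  which misses \<open>e i\<close> wherever \<open>f (e i)\<close> vanishes.\<close>

lemma interval_cover_summand_nonzero:
  fixes X :: "('p::order, nat, 'k::field) rep"
  assumes cov: "interval_cover P M X f" and M: "pmodule P M" and D: "decomp P X A I e c"
    and i: "i \<in> A" and a0: "a0 \<in> I i"
  shows "f a0 (e i a0) \<noteq> 0"
proof
  assume 0: "f a0 (e i a0) = 0"
  have X: "pmodule P X" and f: "pmorphism P X M f"
    using cov by (auto simp: interval_cover_def interval_decomposable_def)
  have IP: "I i \<subseteq> P" using decompD(1)[OF D i] by (simp add: interval_def)
  note e = decompD(2)[OF D i]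
  define v where "v = (\<lambda>a. f a (e i a))"
  have v: "kI_hom P (I i) M v"
    unfolding v_def by (rule kI_hom_pmorphism[OF e f X])
  define S where "S = {a \<in> I i. v a \<noteq> 0}"
  have down: "a \<in> S" if "a \<in> I i" "b \<in> S" "a \<le> b" for a b
  proof -
    have "a \<in> P" "b \<in> P" using that IP by (auto simp: S_def)
    then have "tr M a b (v a) = v b" "tr M a b 0 = 0"
      using kI_homD(3)[OF v] that lin_map_zero[OF pmodule_lin_map[OF M] pmodule_subspace[OF M]] by auto
    then have "v a \<noteq> 0" using that(2) by (auto simp: S_def)
    then show ?thesis using that(1) by (simp add: S_def)
  qed
  have "poset_convex P S"
    unfolding poset_convex_def
  proof (intro ballI impI)
    fix x y z assume xyz: "x \<in> S" "y \<in> S" "z \<in> P" "x < z \<and> z < y"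
    have "x \<in> I i" "y \<in> I i" using xyz by (auto simp: S_def)
    then have "z \<in> I i" using interval_convexD[OF decompD(1)[OF D i]] xyz less_imp_le by blast
    then show "z \<in> S" using down xyz less_imp_le by blast
  qed
  then have int: "interval P (component S a)" if "a \<in> S" for a
    using IP that by (intro component_interval) (auto simp: S_def)
  have "\<exists>w. kI_hom P (component S a) X w \<and> (\<forall>b\<in>P. f b (w b) = (if b \<in> component S a then v b else 0))"
    if a: "a \<in> S" for a
  proof -
    \<comment> \<open>Truncating \<open>v\<close> to one component stays natural: a step upwards
      from it either remains in the component or leaves \<open>S\<close>, where \<open>v\<close> is
      zero.\<close>
    have "kI_hom P (component S a) M (\<lambda>b. if b \<in> component S a then v b else 0)"
      unfolding kI_hom_def
    proof (intro conjI ballI impI; (elim conjE)?)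
      fix b assume "b \<in> P"
      then show "(if b \<in> component S a then v b else 0) \<in> sp M b"
        using kI_homD(1)[OF v] fspace.subspace_0[OF pmodule_subspace[OF M]] by auto
    next
      fix b b' assume b: "b \<in> P" "b' \<in> P" "b \<in> component S a" "b \<le> b'"
      then have "b \<in> S" using component_subset[OF a] by blast
      have "v b' = 0" if "b' \<notin> component S a"
        using component_closed[OF a b(3), of b'] b that kI_homD(2)[OF v b(2)] by (auto simp: S_def)
      then show "tr M b b' (if b \<in> component S a then v b else 0) = (if b' \<in> component S a then v b' else 0)"
        using kI_homD(3)[OF v b(1,2) _ b(4)] b(3) \<open>b \<in> S\<close> by (auto simp: S_def)
    qed simp
    then show ?thesis
      using interval_cover_lifts_kI[OF cov M] int[OF a] by (simp add: lifts_kI_def)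
  qed
  \<comment> \<open>The choice is made for each component and not for each point, so that all points
    of one component use the same lift.\<close>
  then have "\<forall>C\<in>component S ` S. \<exists>w. kI_hom P C X w \<and> (\<forall>b\<in>P. f b (w b) = (if b \<in> C then v b else 0))"
    by blast
  from bchoice[OF this] obtain W where "\<forall>C\<in>component S ` S. kI_hom P C X (W C) \<and> (\<forall>b\<in>P. f b (W C b) = (if b \<in> C then v b else 0))"
    by (elim exE)
  then have W: "kI_hom P (component S a) X (W (component S a))"
    "b \<in> P \<Longrightarrow> b \<in> component S a \<Longrightarrow> f b (W (component S a) b) = v b" if "a \<in> S" for a b
    using that by auto
  define w where "w = (\<lambda>a. if a \<in> S then W (component S a) a else 0)"
  have w: "kI_hom P (I i) X w"
    unfolding kI_hom_def
  proof (intro conjI ballI impI; (elim conjE)?)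
    fix a assume "a \<in> P"
    then show "w a \<in> sp X a"
      using kI_homD(1)[OF W(1)] fspace.subspace_0[OF pmodule_subspace[OF X]] by (simp add: w_def)
  next
    fix a assume "a \<in> P" "a \<notin> I i"
    then show "w a = 0" by (simp add: w_def S_def)
  next
    fix a b assume ab: "a \<in> P" "b \<in> P" "a \<in> I i" "a \<le> b"
    show "tr X a b (w a) = w b"
    proof (cases "a \<in> S")
      case True
      then have "tr X a b (w a) = W (component S a) b"
        using kI_homD(3)[OF W(1)[OF True] ab(1,2) component_refl ab(4)] by (simp add: w_def)
      also have "\<dots> = w b"
      proof (cases "b \<in> S")
        case b: True
        then have "component S b = component S a"
          using component_closed[OF True component_refl b] ab(4) component_eq by blast
        with b show ?thesis by (simp add: w_def)
      next
        case False
        then have "b \<notin> component S a" using component_subset[OF True] by blast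
        with False show ?thesis using kI_homD(2)[OF W(1)[OF True] ab(2)] by (simp add: w_def)
      qed
      finally show ?thesis .
    next
      case False
      then have "b \<notin> S" using down[OF ab(3) _ ab(4)] by blast
      with False show ?thesis
        using lin_map_zero[OF pmodule_lin_map[OF X ab(1,2,4)] pmodule_subspace[OF X ab(1)]]
        by (simp add: w_def)
    qed
  qed
  have fw: "f a (w a) = v a" if a: "a \<in> P" for a
  proof (cases "a \<in> S")
    case True
    then show ?thesis using W(2)[OF True a component_refl] by (simp add: w_def)
  next
    case False
    then show ?thesis
      using kI_homD(2)[OF v a] lin_map_zero[OF pmorphism_lin_map[OF f a] pmodule_subspace[OF X a]]
      by (auto simp: w_def S_def)
  qed
  define g where "g = (\<lambda>a x. x - fscale (c i a x) (e i a - w a))"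
  have ew: "kI_hom P (I i) X (\<lambda>a. e i a - w a)" by (rule kI_hom_diff[OF e w X])
  have g: "pmorphism P X X g"
    unfolding g_def by (rule pmorphism_diff[OF X pmorphism_id coord_pmorphism[OF D i X ew]])
  have "f a (g a x) = f a x" if a: "a \<in> P" and x: "x \<in> sp X a" for a x
  proof -
    note L = pmorphism_lin_map[OF f a] and S = pmodule_subspace[OF X a]
    note in_sp = kI_homD(1)[OF ew a]
    have "f a (g a x) = f a x - fscale (c i a x) (f a (e i a - w a))"
      unfolding g_def using lin_map_diff[OF L S x fspace.subspace_scale[OF S in_sp]]
        lin_mapD(3)[OF L in_sp] by simp
    also have "f a (e i a - w a) = 0"
      using lin_map_diff[OF L S kI_homD(1)[OF e a] kI_homD(1)[OF w a]] fw[OF a] by (simp add: v_def)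
    finally show ?thesis by (simp add: fscale_def)
  qed
  with g cov have "pisomorphism P X X g" by (simp add: interval_cover_def)
  moreover have a0P: "a0 \<in> P" using a0 IP by blast
  ultimately have "bij_betw (g a0) (sp X a0) (sp X a0)" by (simp add: pisomorphism_def)
  then obtain x where x: "x \<in> sp X a0" "g a0 x = e i a0"
    using kI_homD(1)[OF e a0P] by (metis bij_betw_imp_surj_on imageE)
  have "w a0 = 0" using 0 by (simp add: w_def S_def v_def)
  then have "g a0 x = x - fscale (c i a0 x) (e i a0)" by (simp add: g_def)
  then have "c i a0 (g a0 x) = c i a0 x - c i a0 (fscale (c i a0 x) (e i a0))"
    using decomp_diff[OF D X i a0P x(1) fspace.subspace_scale[OF pmodule_subspace[OF X a0P] kI_homD(1)[OF e a0P]]]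
    by simp
  then show False
    using decompD(4)[OF D i a0P kI_homD(1)[OF e a0P]] decompD(5)[OF D i a0P i a0] x(2) by simp
qed

text \<open>Equivalently, the unit map from \<open>N\<close> to the coinduction of its restriction
  to \<open>Q\<close> is injective.\<close>

definition torsion_free :: "'p::order set \<Rightarrow> 'p set \<Rightarrow> ('p, 'i, 'k::field) rep \<Rightarrow> bool" where
  "torsion_free P Q N \<longleftrightarrow>
     (\<forall>a\<in>P. \<forall>x\<in>sp N a. (\<forall>q\<in>Q. a \<le> q \<longrightarrow> tr N a q x = 0) \<longrightarrow> x = 0)"

lemma torsion_free_eqI:
  assumes N: "pmodule P N" and tf: "torsion_free P Q N" and QP: "Q \<subseteq> P"
    and a: "a \<in> P" and x: "x \<in> sp N a" and y: "y \<in> sp N a"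
    and eq: "\<And>q. q \<in> Q \<Longrightarrow> a \<le> q \<Longrightarrow> tr N a q x = tr N a q y"
  shows "x = y"
proof -
  note S = pmodule_subspace[OF N a]
  have "tr N a q (x - y) = 0" if "q \<in> Q" "a \<le> q" for q
    using lin_map_diff[OF pmodule_lin_map[OF N a _ that(2)] S x y] eq[OF that] that QP by auto
  then have "x - y = 0"
    using tf a fspace.subspace_diff[OF S x y] unfolding torsion_free_def by blast
  then show ?thesis by simp
qed

text \<open>If \<open>x\<close> has a nonzero coordinate \<open>i\<close> but dies at every point of
  \<open>Q\<close> above \<open>a\<close>, then no such point lies in \<open>I i\<close>, so
  \<open>e i a\<close> dies there too. Its image under \<open>f\<close> is then torsion in
  \<open>N\<close>, hence zero, against \<open>interval_cover_summand_nonzero\<close>.\<close>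

lemma torsion_free_cover:
  fixes X :: "('p::order, nat, 'k::field) rep"
  assumes cov: "interval_cover P N X f" and N: "pmodule P N" and tf: "torsion_free P Q N" and QP: "Q \<subseteq> P"
  shows "torsion_free P Q X"
  unfolding torsion_free_def
proof (intro ballI impI)
  fix a x assume a: "a \<in> P" and x: "x \<in> sp X a" and tx: "\<forall>q\<in>Q. a \<le> q \<longrightarrow> tr X a q x = 0"
  have X: "pmodule P X" and dX: "interval_decomposable P X" and f: "pmorphism P X N f"
    using cov by (auto simp: interval_cover_def interval_decomposable_def)
  obtain A :: "nat set" and I e c where D: "decomp P X A I e c"
    using interval_decomposable_decomp[OF dX] .
  have "c i a x = 0" if i: "i \<in> A" for i
  proof (rule ccontr)
    assume c: "c i a x \<noteq> 0"
    then have aI: "a \<in> I i" using decompD(6)[OF D i a x] by blast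
    note e = decompD(2)[OF D i]
    have "tr N a q (f a (e i a)) = 0" if q: "q \<in> Q" "a \<le> q" for q
    proof -
      have qP: "q \<in> P" using q QP by blast
      have "q \<notin> I i"
        using decompD(7)[OF D i a qP q(2) x] tx q c decomp_zero[OF D X i qP] by auto
      then have "tr X a q (e i a) = 0"
        using kI_homD(3)[OF e a qP aI q(2)] kI_homD(2)[OF e qP] by simp
      then show ?thesis
        using pmorphism_tr[OF f a qP q(2) kI_homD(1)[OF e a]]
          lin_map_zero[OF pmorphism_lin_map[OF f qP] pmodule_subspace[OF X qP]] by simp
    qed
    then have "f a (e i a) = 0"
      using tf a lin_mapD(1)[OF pmorphism_lin_map[OF f a] kI_homD(1)[OF e a]]
      unfolding torsion_free_def by blast
    then show False using interval_cover_summand_nonzero[OF cov N D i aI] by simp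
  qed
  then show "x = 0"
    using decomp_zero[OF D X _ a] fspace.subspace_0[OF pmodule_subspace[OF X a]]
    by (intro decomp_eqI[OF D a x]) auto
qed

lemma torsion_free_kernel: "torsion_free P Q X \<Longrightarrow> torsion_free P Q (kernel X f)"
  by (simp add: torsion_free_def)

section \<open>Convex hulls and extension of morphisms from \<open>Q\<close> to
  \<open>P\<close>\<close>

definition convex_hull_in :: "'p::order set \<Rightarrow> 'p set \<Rightarrow> 'p set" where
  "convex_hull_in P I = {p \<in> P. \<exists>x\<in>I. \<exists>y\<in>I. x \<le> p \<and> p \<le> y}"

text \<open>Each point of the hull lies above a point of \<open>I\<close>, so connectedness is
  inherited from \<open>I\<close>.\<close>

lemma convex_hull_in_interval:
  assumes I: "interval Q I" and QP: "Q \<subseteq> P"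
  shows "interval P (convex_hull_in P I)"
proof -
  let ?H = "convex_hull_in P I"
  let ?R = "{(u, v). u \<in> ?H \<and> v \<in> ?H \<and> (u \<le> v \<or> v \<le> u)}"
  have IP: "I \<subseteq> P" using I QP by (auto simp: interval_def)
  have IH: "I \<subseteq> ?H" using IP by (auto simp: convex_hull_in_def)
  have conn: "(p, p') \<in> ?R\<^sup>*" if p: "p \<in> ?H" "p' \<in> ?H" for p p'
  proof -
    obtain q q' where q: "q \<in> I" "q \<le> p" "q' \<in> I" "q' \<le> p'"
      using p by (auto simp: convex_hull_in_def)
    have "(q, q') \<in> {(u, v). u \<in> I \<and> v \<in> I \<and> (u \<le> v \<or> v \<le> u)}\<^sup>*"
      using I q(1,3) by (simp add: interval_def poset_connected_def)
    then have "(q, q') \<in> ?R\<^sup>*"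
      by (rule rtrancl_mono[THEN subsetD, rotated]) (use IH in auto)
    moreover have "(p, q) \<in> ?R" "(q', p') \<in> ?R" using p q IH by auto
    ultimately show ?thesis by (meson converse_rtrancl_into_rtrancl rtrancl.rtrancl_into_rtrancl)
  qed
  have "poset_convex P ?H"
    unfolding poset_convex_def
  proof (intro ballI impI)
    fix x y z assume xyz: "x \<in> ?H" "y \<in> ?H" "z \<in> P" "x < z \<and> z < y"
    obtain u v where "u \<in> I" "v \<in> I" "u \<le> x" "y \<le> v"
      using xyz(1,2) by (auto simp: convex_hull_in_def)
    moreover have "u \<le> z" "z \<le> v"
      using xyz(4) calculation by (meson less_imp_le order_trans)+
    ultimately show "z \<in> ?H" using xyz(3) by (auto simp: convex_hull_in_def)
  qed
  moreover have "?H \<noteq> {}" using IH I by (auto simp: interval_def)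
  moreover have "?H \<subseteq> P" by (auto simp: convex_hull_in_def)
  moreover have "poset_connected ?H" unfolding poset_connected_def using conn by blast
  ultimately show ?thesis by (simp add: interval_def)
qed

text \<open>The extension of \<open>h\<close> to the hull is determined by its images at points of
  \<open>Q\<close>; torsion-freeness turns agreement of these images into equality, which yields
  naturality. The extension is lifted through \<open>f\<close> over \<open>P\<close>, and the lift
  is then read over \<open>Q\<close>.\<close>

lemma lifts_kI_restrict:
  assumes N: "pmodule P N" and f: "pmorphism P X N f" and tf: "torsion_free P Q N"
    and lift: "lifts_kI P X N f" and QP: "Q \<subseteq> P"
  shows "lifts_kI Q X N f"
  unfolding lifts_kI_def
proof safe
  fix I h assume I: "interval Q I" and h: "kI_hom Q I N h"
  define H where "H = convex_hull_in P I"
  have IQ: "I \<subseteq> Q" using I by (simp add: interval_def)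
  \<comment> \<open>Convexity of \<open>I\<close> in \<open>Q\<close> means that the hull adds no
    point of \<open>Q\<close>; this is what lets a morphism out of k_H restrict to one out of
    k_I.\<close>
  have HQ: "q \<in> H \<longleftrightarrow> q \<in> I" if "q \<in> Q" for q
  proof
    assume "q \<in> H"
    then obtain x y where "x \<in> I" "y \<in> I" "x \<le> q" "q \<le> y" by (auto simp: H_def convex_hull_in_def)
    then show "q \<in> I" by (intro interval_convexD[OF I _ _ that])
  next
    assume "q \<in> I"
    then show "q \<in> H" using that QP by (auto simp: H_def convex_hull_in_def)
  qed
  \<comment> \<open>Any \<open>q \<in> I\<close> below \<open>p\<close> provides the value
    \<open>tr N q p (h q)\<close>; its images \<open>h t\<close> no longer depend on
    \<open>q\<close>.\<close>
  have "\<exists>x\<in>sp N p. \<forall>t\<in>Q. p \<le> t \<longrightarrow> tr N p t x = h t" if p: "p \<in> H" for p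
  proof -
    obtain q where q: "q \<in> I" "q \<le> p" using p by (auto simp: H_def convex_hull_in_def)
    have "q \<in> Q" "q \<in> P" "p \<in> P" using q p IQ QP by (auto simp: H_def convex_hull_in_def)
    note hq = kI_homD(1)[OF h \<open>q \<in> Q\<close>]
    have "tr N p t (tr N q p (h q)) = h t" if t: "t \<in> Q" "p \<le> t" for t
    proof -
      have "t \<in> P" "q \<le> t" using t q QP by auto
      then show ?thesis
        using pmodule_tr_tr[OF N \<open>q \<in> P\<close> \<open>p \<in> P\<close> _ q(2) t(2) hq] kI_homD(3)[OF h \<open>q \<in> Q\<close> t(1) q(1)] by simp
    qed
    moreover have "tr N q p (h q) \<in> sp N p"
      using lin_mapD(1)[OF pmodule_lin_map[OF N \<open>q \<in> P\<close> \<open>p \<in> P\<close> q(2)] hq] .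
    ultimately show ?thesis by blast
  qed
  then have "\<forall>p\<in>H. \<exists>x. x \<in> sp N p \<and> (\<forall>t\<in>Q. p \<le> t \<longrightarrow> tr N p t x = h t)" by blast
  from bchoice[OF this] obtain v0 where v0: "\<forall>p\<in>H. v0 p \<in> sp N p \<and> (\<forall>t\<in>Q. p \<le> t \<longrightarrow> tr N p t (v0 p) = h t)"
    by (elim exE)
  define v where "v = (\<lambda>p. if p \<in> H then v0 p else 0)"
  have vin: "v p \<in> sp N p" if "p \<in> P" for p
    using v0 fspace.subspace_0[OF pmodule_subspace[OF N that]] by (simp add: v_def)
  have vH: "tr N p t (v p) = h t" if "p \<in> H" "t \<in> Q" "p \<le> t" for p t
    using v0 that by (simp add: v_def)
  have v: "kI_hom P H N v"
    unfolding kI_hom_def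
  proof (intro conjI ballI impI; (elim conjE)?)
    fix a b assume ab: "a \<in> P" "b \<in> P" "a \<in> H" "a \<le> b"
    show "tr N a b (v a) = v b"
    proof (rule torsion_free_eqI[OF N tf QP ab(2) _ vin[OF ab(2)]])
      show "tr N a b (v a) \<in> sp N b"
        using lin_mapD(1)[OF pmodule_lin_map[OF N ab(1,2,4)] vin[OF ab(1)]] .
      fix t assume t: "t \<in> Q" "b \<le> t"
      have tP: "t \<in> P" "a \<le> t" using t ab QP by auto
      have "tr N b t (tr N a b (v a)) = h t"
        using pmodule_tr_tr[OF N ab(1,2) tP(1) ab(4) t(2) vin[OF ab(1)]] vH[OF ab(3) t(1) tP(2)] by simp
      also have "h t = tr N b t (v b)"
      proof (cases "b \<in> H")
        case True
        then show ?thesis using vH t by simp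
      next
        case False
        \<comment> \<open>Otherwise \<open>b\<close> would lie between a point of \<open>I\<close>
          below \<open>a\<close> and \<open>t\<close>, hence in the hull. So both sides are
          zero.\<close>
        have "t \<notin> I"
        proof
          assume "t \<in> I"
          obtain x where "x \<in> I" "x \<le> a" using ab(3) by (auto simp: H_def convex_hull_in_def)
          then have "b \<in> H" using \<open>t \<in> I\<close> ab t by (auto simp: H_def convex_hull_in_def intro: order_trans)
          with False show False ..
        qed
        then show ?thesis
          using kI_homD(2)[OF h t(1)] False
            lin_map_zero[OF pmodule_lin_map[OF N ab(2) tP(1) t(2)] pmodule_subspace[OF N ab(2)]]
          by (simp add: v_def)
      qed
      finally show "tr N b t (tr N a b (v a)) = tr N b t (v b)" .
    qed
  qed (use vin in \<open>auto simp: v_def\<close>)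
  have vh: "v q = h q" if q: "q \<in> Q" for q
  proof (cases "q \<in> I")
    case True
    then show ?thesis
      using vH[of q q] HQ[OF q] q pmodule_tr_id[OF N _ vin] QP by auto
  next
    case False
    then show ?thesis using HQ[OF q] kI_homD(2)[OF h q] by (simp add: v_def)
  qed
  have "interval P H" unfolding H_def by (rule convex_hull_in_interval[OF I QP])
  then obtain w where w: "kI_hom P H X w" and fw: "\<And>a. a \<in> P \<Longrightarrow> f a (w a) = v a"
    using lift v unfolding lifts_kI_def by blast
  have "kI_hom Q I X w"
    using kI_homD[OF w] QP HQ unfolding kI_hom_def by (meson subsetD)
  moreover have "f a (w a) = h a" if "a \<in> Q" for a
    using fw vh that QP by auto
  ultimately show "\<exists>w. kI_hom Q I X w \<and> (\<forall>a\<in>Q. f a (w a) = h a)" by blast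
qed

section \<open>Retracts and syzygies\<close>

definition retract :: "'p::order set \<Rightarrow> ('p, 'i, 'k::field) rep \<Rightarrow> ('p, 'j, 'k) rep \<Rightarrow> bool" where
  "retract Q M N \<longleftrightarrow> (\<exists>s r. pmorphism Q M N s \<and> pmorphism Q N M r \<and> (\<forall>a\<in>Q. \<forall>x\<in>sp M a. r a (s a x) = x))"

lemma retract_zero_module:
  assumes M: "pmodule Q M" and MN: "retract Q M N" and N: "zero_module Q N"
  shows "zero_module Q M"
  unfolding zero_module_def
proof (intro ballI)
  fix a assume a: "a \<in> Q"
  obtain s r where s: "pmorphism Q M N s" and r: "pmorphism Q N M r" and rs: "\<forall>a\<in>Q. \<forall>x\<in>sp M a. r a (s a x) = x"
    using MN by (auto simp: retract_def)
  have Na: "sp N a = {0}" using N a by (simp add: zero_module_def)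
  have "x = 0" if x: "x \<in> sp M a" for x
  proof -
    have s0: "s a x = 0" "s a 0 = 0" and M0: "0 \<in> sp M a"
      using lin_mapD(1)[OF pmorphism_lin_map[OF s a]] x Na fspace.subspace_0[OF pmodule_subspace[OF M a]] by auto
    have "x = r a (s a x)" "0 = r a (s a 0)" using rs a x M0 by auto
    with s0 show "x = 0" by simp
  qed
  then show "sp M a = {0}" using fspace.subspace_0[OF pmodule_subspace[OF M a]] by auto
qed

text \<open>Composing \<open>f\<close> with \<open>r\<close> makes \<open>X\<close> over
  \<open>Q\<close> an approximation of \<open>M\<close>, so a cover \<open>h\<close> of
  \<open>M\<close> exists. Lifting produces \<open>\<alpha>\<close> from \<open>Z\<close> to
  \<open>X\<close> over \<open>s\<close> and \<open>\<beta>\<close> back over \<open>r\<close>.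
  Their composite \<open>u\<close> lies over the identity of \<open>M\<close>, so minimality makes
  it invertible, and \<open>\<alpha>\<close> is split; both maps restrict to the kernels.\<close>

lemma retract_syzygy:
  fixes X :: "('p::order, nat, 'k::field) rep"
  assumes P: "finite P" and QP: "Q \<subseteq> P" and M: "pmodule Q M" and N: "pmodule P N"
    and tf: "torsion_free P Q N" and MN: "retract Q M N" and cov: "interval_cover P N X f"
  shows "\<exists>Z h. interval_cover Q M Z h \<and> retract Q (kernel Z h) (kernel X f)"
proof -
  obtain s r where s: "pmorphism Q M N s" and r: "pmorphism Q N M r" and rs: "\<And>a x. a \<in> Q \<Longrightarrow> x \<in> sp M a \<Longrightarrow> r a (s a x) = x"
    using MN by (auto simp: retract_def)
  have X: "pmodule P X" and dX: "interval_decomposable P X" and f: "pmorphism P X N f"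
    using cov by (auto simp: interval_cover_def interval_decomposable_def)
  note NQ = pmodule_subset[OF N QP] and XQ = pmodule_subset[OF X QP] and fQ = pmorphism_subset[OF f QP]
  have lift: "lifts_kI Q X N f"
    by (rule lifts_kI_restrict[OF N f tf interval_cover_lifts_kI[OF cov N] QP])
  obtain A :: "nat set" and I e c where "decomp P X A I e c"
    using interval_decomposable_decomp[OF dX] .
  from decomp_restrict[OF P QP X this] obtain e' c' where
    D: "decomp Q X (SIGMA i:A. component (I i \<inter> Q) ` (I i \<inter> Q)) snd e' c'" .
  have rf: "pmorphism Q X M (\<lambda>a x. r a (f a x))" by (rule pmorphism_comp[OF fQ r])
  have liftM: "lifts_kI Q X M (\<lambda>a x. r a (f a x))"
    unfolding lifts_kI_def
  proof safe
    fix J v assume "interval Q J" and v: "kI_hom Q J M v"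
    moreover have "kI_hom Q J N (\<lambda>a. s a (v a))" by (rule kI_hom_pmorphism[OF v s M])
    ultimately obtain w where w: "kI_hom Q J X w" "\<And>a. a \<in> Q \<Longrightarrow> f a (w a) = s a (v a)"
      using lift unfolding lifts_kI_def by blast
    then show "\<exists>w. kI_hom Q J X w \<and> (\<forall>a\<in>Q. r a (f a (w a)) = v a)"
      using rs kI_homD(1)[OF v] by (intro exI[of _ w]) simp
  qed
  obtain Z h where covM: "interval_cover Q M Z h"
    using interval_cover_exists[OF M XQ D rf liftM] .
  then have Z: "pmodule Q Z" and dZ: "interval_decomposable Q Z" and h: "pmorphism Q Z M h"
    by (auto simp: interval_cover_def interval_decomposable_def)
  obtain \<alpha> where \<alpha>: "pmorphism Q Z X \<alpha>" and f\<alpha>: "\<And>a z. a \<in> Q \<Longrightarrow> z \<in> sp Z a \<Longrightarrow> f a (\<alpha> a z) = s a (h a z)"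
    using lift_interval_decomposable[OF dZ XQ NQ fQ pmorphism_comp[OF h s] lift] by auto
  have "interval_decomposable Q X" by (rule decomp_interval_decomposable[OF XQ D])
  then obtain \<beta> where \<beta>: "pmorphism Q X Z \<beta>" and h\<beta>: "\<And>a x. a \<in> Q \<Longrightarrow> x \<in> sp X a \<Longrightarrow> h a (\<beta> a x) = r a (f a x)"
    using lift_interval_decomposable[OF _ Z M h rf interval_cover_lifts_kI[OF covM M]] by auto
  define u where "u = (\<lambda>a z. \<beta> a (\<alpha> a z))"
  have u: "pmorphism Q Z Z u" unfolding u_def by (rule pmorphism_comp[OF \<alpha> \<beta>])
  note \<alpha>in = lin_mapD(1)[OF pmorphism_lin_map[OF \<alpha>]] and \<beta>in = lin_mapD(1)[OF pmorphism_lin_map[OF \<beta>]]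
    and hin = lin_mapD(1)[OF pmorphism_lin_map[OF h]]
  have hu: "h a (u a z) = h a z" if "a \<in> Q" "z \<in> sp Z a" for a z
    using h\<beta>[OF that(1) \<alpha>in[OF that]] f\<alpha>[OF that] rs[OF that(1) hin[OF that]] by (simp add: u_def)
  have iso: "pisomorphism Q Z Z u"
    using covM u hu by (simp add: interval_cover_def)
  define u' where "u' = (\<lambda>a. inv_into (sp Z a) (u a))"
  have u': "pmorphism Q Z Z u'"
    using pisomorphism_inverse[OF Z iso] by (simp add: pisomorphism_def u'_def)
  note u'in = lin_mapD(1)[OF pmorphism_lin_map[OF u']]
  have bij: "bij_betw (u a) (sp Z a) (sp Z a)" if "a \<in> Q" for a
    using iso that by (simp add: pisomorphism_def)
  have u'u: "u' a (u a z) = z" and uu': "u a (u' a z) = z" if "a \<in> Q" "z \<in> sp Z a" for a z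
    using bij[OF that(1)] that(2) by (auto simp: u'_def bij_betw_def f_inv_into_f)
  \<comment> \<open>The inverse of \<open>u\<close> lies over the identity of \<open>M\<close> as
    well, so correcting \<open>\<beta>\<close> by it still sends the kernel of \<open>f\<close> into
    the kernel of \<open>h\<close>.\<close>
  have hu': "h a (u' a z) = h a z" if "a \<in> Q" "z \<in> sp Z a" for a z
    using hu[OF that(1) u'in[OF that]] uu'[OF that] by simp
  have s0: "s a 0 = 0" if "a \<in> Q" for a
    using lin_map_zero[OF pmorphism_lin_map[OF s that] pmodule_subspace[OF M that]] .
  have r0: "r a 0 = 0" if "a \<in> Q" for a
    using lin_map_zero[OF pmorphism_lin_map[OF r that] pmodule_subspace[OF NQ that]] .
  have "pmorphism Q (kernel Z h) (kernel X f) \<alpha>"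
    using \<alpha> f\<alpha> s0 by (auto simp: pmorphism_def lin_map_def image_subset_iff)
  moreover have "pmorphism Q (kernel X f) (kernel Z h) (\<lambda>a x. u' a (\<beta> a x))"
    using pmorphism_comp[OF \<beta> u'] hu' \<beta>in h\<beta> r0
    by (auto simp: pmorphism_def lin_map_def image_subset_iff)
  ultimately have "retract Q (kernel Z h) (kernel X f)"
    unfolding retract_def using u'u by (intro exI[of _ \<alpha>] exI[of _ "\<lambda>a x. u' a (\<beta> a x)"]) (simp add: u_def)
  with covM show ?thesis by blast
qed

text \<open>The syzygies over \<open>P\<close> are given and those over \<open>Q\<close> are built
  alongside. Torsion-freeness belongs to the induction statement because every step consumes it for
  the current syzygy.\<close>

lemma syzygy_retract:
  fixes M0 N0 :: "('p::order, nat, 'k::field) rep"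
  assumes P: "finite P" and QP: "Q \<subseteq> P" and M0: "pmodule Q M0" and N0: "pmodule P N0"
    and tf0: "torsion_free P Q N0" and MN0: "retract Q M0 N0" and syz: "syzygy P N0 i N"
  shows "pmodule P N \<and> torsion_free P Q N \<and> (\<exists>M. pmodule Q M \<and> syzygy Q M0 i M \<and> retract Q M N)"
  using syz
proof induction
  case syzygy_0
  then show ?case using assms syzygy.syzygy_0 by blast
next
  case (syzygy_Suc i N X f)
  then obtain M where N: "pmodule P N" and tf: "torsion_free P Q N" and M: "pmodule Q M"
    and syz: "syzygy Q M0 i M" and MN: "retract Q M N" by blast
  note cov = syzygy_Suc(2)
  obtain Z h where Z: "interval_cover Q M Z h" "retract Q (kernel Z h) (kernel X f)"
    using retract_syzygy[OF P QP M N tf MN cov] by blast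
  have "pmodule Q (kernel Z h)" "pmodule P (kernel X f)"
    using Z(1) cov M N by (auto simp: interval_cover_def interval_decomposable_def intro!: kernel_pmodule)
  moreover have "syzygy Q M0 (Suc i) (kernel Z h)"
    by (rule syzygy.syzygy_Suc[OF syz Z(1)])
  moreover have "torsion_free P Q (kernel X f)"
    by (rule torsion_free_kernel[OF torsion_free_cover[OF cov N tf QP]])
  ultimately show ?case using Z(2) by blast
qed

section \<open>Coinduction\<close>

text \<open>An element of the coinduced module at \<open>a\<close> is a compatible family \<open>(x q)\<close> indexed by the \<open>q \<in> Q\<close>
  above \<open>a\<close>, stored in a single sequence: the injection \<open>\<iota>\<close> numbers the elements of \<open>Q\<close>, and the
  \<open>j\<close>-th entry of \<open>x q\<close> sits at position \<open>prod_encode (\<iota> q, j)\<close>.\<close>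

definition slot :: "('p \<Rightarrow> nat) \<Rightarrow> 'p \<Rightarrow> (nat \<Rightarrow> 'k) \<Rightarrow> nat \<Rightarrow> 'k" where
  "slot \<iota> q y = (\<lambda>j. y (prod_encode (\<iota> q, j)))"

definition coind :: "('p \<Rightarrow> nat) \<Rightarrow> 'p::order set \<Rightarrow> ('p, nat, 'k::field) rep \<Rightarrow> ('p, nat, 'k) rep" where
  "coind \<iota> Q M = \<lparr>
     sp = (\<lambda>a. {y. (\<forall>q\<in>Q. a \<le> q \<longrightarrow> slot \<iota> q y \<in> sp M q)
       \<and> (\<forall>q\<in>Q. \<forall>q'\<in>Q. a \<le> q \<and> q \<le> q' \<longrightarrow> tr M q q' (slot \<iota> q y) = slot \<iota> q' y)
       \<and> (\<forall>m. y m \<noteq> 0 \<longrightarrow> (\<exists>q\<in>Q. a \<le> q \<and> fst (prod_decode m) = \<iota> q))}),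
     tr = (\<lambda>a b y m. if \<exists>q\<in>Q. b \<le> q \<and> fst (prod_decode m) = \<iota> q then y m else 0)\<rparr>"

lemma slot_add: "slot \<iota> q (x + y) = slot \<iota> q x + slot \<iota> q y"
  by (auto simp: slot_def)

lemma slot_scale: "slot \<iota> q (fscale c x) = fscale c (slot \<iota> q x)"
  by (simp add: slot_def fscale_def)

lemma slot_zero [simp]: "slot \<iota> q 0 = 0"
  by (auto simp: slot_def)

lemma coind_in:
  "y \<in> sp (coind \<iota> Q M) a \<longleftrightarrow> (\<forall>q\<in>Q. a \<le> q \<longrightarrow> slot \<iota> q y \<in> sp M q)
       \<and> (\<forall>q\<in>Q. \<forall>q'\<in>Q. a \<le> q \<and> q \<le> q' \<longrightarrow> tr M q q' (slot \<iota> q y) = slot \<iota> q' y)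
       \<and> (\<forall>m. y m \<noteq> 0 \<longrightarrow> (\<exists>q\<in>Q. a \<le> q \<and> fst (prod_decode m) = \<iota> q))"
  by (simp add: coind_def)

lemma coindD:
  assumes "y \<in> sp (coind \<iota> Q M) a" "q \<in> Q" "a \<le> q"
  shows "slot \<iota> q y \<in> sp M q"
    "q' \<in> Q \<Longrightarrow> q \<le> q' \<Longrightarrow> tr M q q' (slot \<iota> q y) = slot \<iota> q' y"
  using assms unfolding coind_in by blast+

text \<open>The support clause of \<open>coind\<close> forbids nonzero entries outside the slots of
  the \<open>q \<in> Q\<close> above \<open>a\<close>, so an element carries no data beyond its
  family.\<close>

lemma coind_eqI:
  assumes x: "x \<in> sp (coind \<iota> Q M) a" and y: "y \<in> sp (coind \<iota> Q M) a"
    and eq: "\<And>q. q \<in> Q \<Longrightarrow> a \<le> q \<Longrightarrow> slot \<iota> q x = slot \<iota> q y"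
  shows "x = y"
proof
  fix m
  show "x m = y m"
  proof (cases "\<exists>q\<in>Q. a \<le> q \<and> fst (prod_decode m) = \<iota> q")
    case True
    then obtain q where q: "q \<in> Q" "a \<le> q" "fst (prod_decode m) = \<iota> q" by blast
    then have "m = prod_encode (\<iota> q, snd (prod_decode m))"
      by (metis prod.collapse prod_decode_inverse)
    then show ?thesis using eq[OF q(1,2)] unfolding slot_def by metis
  next
    case False
    then have "x m = 0" "y m = 0" using x y unfolding coind_in by blast+
    then show ?thesis by simp
  qed
qed

lemma slot_coind_tr:
  assumes "inj_on \<iota> Q" "q \<in> Q"
  shows "slot \<iota> q (tr (coind \<iota> Q M) a b y) = (if b \<le> q then slot \<iota> q y else 0)"
  using assms by (auto simp: slot_def coind_def fun_eq_iff inj_on_def)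

lemma coind_subspace:
  assumes M: "pmodule Q M"
  shows "fspace.subspace (sp (coind \<iota> Q M) a)"
  unfolding fspace.subspace_def
proof (intro conjI ballI allI)
  note S = pmodule_subspace[OF M] and L = pmodule_lin_map[OF M]
  show "0 \<in> sp (coind \<iota> Q M) a"
    using fspace.subspace_0[OF S] lin_map_zero[OF L S] unfolding coind_in by simp
  fix x y assume x: "x \<in> sp (coind \<iota> Q M) a" and y: "y \<in> sp (coind \<iota> Q M) a"
  have "\<exists>q\<in>Q. a \<le> q \<and> fst (prod_decode m) = \<iota> q" if "(x + y) m \<noteq> 0" for m
  proof -
    have "x m \<noteq> 0 \<or> y m \<noteq> 0" using that by auto
    then show ?thesis using x y unfolding coind_in by blast
  qed
  then show "x + y \<in> sp (coind \<iota> Q M) a"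
    using fspace.subspace_add[OF S] lin_mapD(2)[OF L] coindD[OF x] coindD[OF y]
    unfolding coind_in by (simp add: slot_add)
next
  note S = pmodule_subspace[OF M] and L = pmodule_lin_map[OF M]
  fix c x assume x: "x \<in> sp (coind \<iota> Q M) a"
  have "\<exists>q\<in>Q. a \<le> q \<and> fst (prod_decode m) = \<iota> q" if "fscale c x m \<noteq> 0" for m
  proof -
    have "x m \<noteq> 0" using that by (auto simp: fscale_def)
    then show ?thesis using x unfolding coind_in by blast
  qed
  then show "fscale c x \<in> sp (coind \<iota> Q M) a"
    using fspace.subspace_scale[OF S] lin_mapD(3)[OF L] coindD[OF x]
    unfolding coind_in by (simp add: slot_scale)
qed

text \<open>Compatible families lie in the finite direct sum of the spaces \<open>sp M q\<close>,
  which is spanned by the images of finite spanning sets \<open>B q\<close> under the embeddings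
  \<open>emb q\<close>.\<close>

lemma coind_fd_subspace:
  assumes Q: "finite Q" and inj: "inj_on \<iota> Q" and M: "pmodule Q M"
  shows "fd_subspace (sp (coind \<iota> Q M) a)"
proof -
  have "\<forall>q\<in>Q. \<exists>B. finite B \<and> sp M q = fspace.span B"
    using M by (simp add: pmodule_def fd_subspace_def)
  from bchoice[OF this] obtain B where B: "\<And>q. q \<in> Q \<Longrightarrow> finite (B q)" "\<And>q. q \<in> Q \<Longrightarrow> sp M q = fspace.span (B q)"
    by blast
  define emb :: "_ \<Rightarrow> (nat \<Rightarrow> 'b) \<Rightarrow> nat \<Rightarrow> 'b"
    where "emb = (\<lambda>q x m. if fst (prod_decode m) = \<iota> q then x (snd (prod_decode m)) else 0)"
  define T where "T = (\<Union>q\<in>Q. emb q ` B q)"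
  have emb: "emb q x \<in> fspace.span T" if q: "q \<in> Q" and x: "x \<in> sp M q" for q x
  proof -
    have "emb q (x + y) = emb q x + emb q y" "emb q (fscale c x) = fscale c (emb q x)" "emb q 0 = 0" for x y c
      by (auto simp: emb_def fscale_def fun_eq_iff)
    then have "fspace.subspace {x. emb q x \<in> fspace.span T}"
      unfolding fspace.subspace_def by (simp add: fspace.span_add fspace.span_scale fspace.span_zero)
    moreover have "B q \<subseteq> {x. emb q x \<in> fspace.span T}"
      using q by (auto simp: T_def intro!: fspace.span_base)
    ultimately have "fspace.span (B q) \<subseteq> {x. emb q x \<in> fspace.span T}"
      by (rule fspace.span_minimal[rotated])
    then show ?thesis using x B(2)[OF q] by blast
  qed
  have "sp (coind \<iota> Q M) a \<subseteq> fspace.span T"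
  proof
    fix y assume y: "y \<in> sp (coind \<iota> Q M) a"
    have "y = (\<Sum>q\<in>{q \<in> Q. a \<le> q}. emb q (slot \<iota> q y))"
    proof
      fix m
      obtain i j where m: "m = prod_encode (i, j)" by (metis prod.exhaust prod_decode_inverse)
      have "(\<Sum>q\<in>{q \<in> Q. a \<le> q}. emb q (slot \<iota> q y)) m = (\<Sum>q\<in>{q \<in> Q. a \<le> q}. if i = \<iota> q then y m else 0)"
        unfolding sum_fun_apply by (intro sum.cong) (auto simp: emb_def slot_def m)
      also have "\<dots> = y m"
      proof (cases "\<exists>q\<in>Q. a \<le> q \<and> i = \<iota> q")
        case True
        then obtain q where q: "q \<in> Q" "a \<le> q" "i = \<iota> q" by blast
        have "(\<Sum>q'\<in>{q \<in> Q. a \<le> q}. if i = \<iota> q' then y m else 0) = (\<Sum>q'\<in>{q \<in> Q. a \<le> q}. if q' = q then y m else 0)"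
          using q inj by (intro sum.cong) (auto simp: inj_on_def)
        then show ?thesis using q Q by simp
      next
        case False
        then have "y m = 0" using y unfolding coind_in by (auto simp: m)
        then show ?thesis by (simp cong: if_cong)
      qed
      finally show "y m = (\<Sum>q\<in>{q \<in> Q. a \<le> q}. emb q (slot \<iota> q y)) m" by simp
    qed
    moreover have "(\<Sum>q\<in>{q \<in> Q. a \<le> q}. emb q (slot \<iota> q y)) \<in> fspace.span T"
      using emb coindD(1)[OF y] by (intro fspace.span_sum) simp
    ultimately show "y \<in> fspace.span T" by simp
  qed
  moreover have "finite T" using Q B(1) by (simp add: T_def)
  then have "fd_subspace (fspace.span T)" unfolding fd_subspace_def by (intro exI[of _ T]) simp
  ultimately show ?thesis using fd_subspace_subset[OF coind_subspace[OF M]] by blast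
qed

lemma coind_tr_in:
  assumes inj: "inj_on \<iota> Q" and y: "y \<in> sp (coind \<iota> Q M) a" and ab: "a \<le> b"
  shows "tr (coind \<iota> Q M) a b y \<in> sp (coind \<iota> Q M) b"
proof -
  have "\<exists>q\<in>Q. b \<le> q \<and> fst (prod_decode m) = \<iota> q" if "tr (coind \<iota> Q M) a b y m \<noteq> 0" for m
    using that by (auto simp: coind_def split: if_splits)
  moreover have "slot \<iota> q y \<in> sp M q" if "q \<in> Q" "b \<le> q" for q
    using coindD(1)[OF y] that ab order_trans by blast
  moreover have "tr M q q' (slot \<iota> q y) = slot \<iota> q' y" if "q \<in> Q" "q' \<in> Q" "b \<le> q" "q \<le> q'" for q q'
    using coindD(2)[OF y] that ab order_trans by blast
  ultimately show ?thesis
    unfolding coind_in by (auto simp: slot_coind_tr[OF inj] dest: order_trans)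
qed

lemma coind_pmodule:
  assumes Q: "finite Q" and inj: "inj_on \<iota> Q" and M: "pmodule Q M"
  shows "pmodule P (coind \<iota> Q M)"
proof -
  have "tr (coind \<iota> Q M) a a x = x" if "x \<in> sp (coind \<iota> Q M) a" for a x
    by (rule coind_eqI[OF coind_tr_in[OF inj that order_refl] that]) (simp add: slot_coind_tr[OF inj])
  moreover have "tr (coind \<iota> Q M) b c (tr (coind \<iota> Q M) a b x) = tr (coind \<iota> Q M) a c x"
    if "a \<le> b" "b \<le> c" "x \<in> sp (coind \<iota> Q M) a" for a b c x
  proof (rule coind_eqI)
    show "tr (coind \<iota> Q M) b c (tr (coind \<iota> Q M) a b x) \<in> sp (coind \<iota> Q M) c"
      by (intro coind_tr_in[OF inj] that)
    show "tr (coind \<iota> Q M) a c x \<in> sp (coind \<iota> Q M) c"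
      using coind_tr_in[OF inj that(3)] that(1,2) order_trans by blast
    fix q assume q: "q \<in> Q" "c \<le> q"
    then have "b \<le> q" using that by (meson order_trans)
    then show "slot \<iota> q (tr (coind \<iota> Q M) b c (tr (coind \<iota> Q M) a b x)) = slot \<iota> q (tr (coind \<iota> Q M) a c x)"
      using q by (simp add: slot_coind_tr[OF inj])
  qed
  moreover have "lin_map (sp (coind \<iota> Q M) a) (sp (coind \<iota> Q M) b) (tr (coind \<iota> Q M) a b)" if "a \<le> b" for a b
  proof -
    have "tr (coind \<iota> Q M) a b (x + y) = tr (coind \<iota> Q M) a b x + tr (coind \<iota> Q M) a b y"
      and "tr (coind \<iota> Q M) a b (fscale c x) = fscale c (tr (coind \<iota> Q M) a b x)" for x y c
      by (auto simp: coind_def fscale_def fun_eq_iff)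
    then show ?thesis
      using coind_tr_in[OF inj _ that] by (auto simp: lin_map_def)
  qed
  ultimately show ?thesis
    using coind_fd_subspace[OF Q inj M] by (simp add: pmodule_def)
qed

text \<open>The map to \<open>q\<close> leaves the slot of \<open>q\<close> intact, so an element
  killed by all these maps has only zero slots.\<close>

lemma coind_torsion_free:
  assumes inj: "inj_on \<iota> Q" and M: "pmodule Q M"
  shows "torsion_free P Q (coind \<iota> Q M)"
  unfolding torsion_free_def
proof (intro ballI impI)
  fix a x assume x: "x \<in> sp (coind \<iota> Q M) a" and 0: "\<forall>q\<in>Q. a \<le> q \<longrightarrow> tr (coind \<iota> Q M) a q x = 0"
  show "x = 0"
  proof (rule coind_eqI[OF x fspace.subspace_0[OF coind_subspace[OF M]]])
    fix q assume q: "q \<in> Q" "a \<le> q"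
    then show "slot \<iota> q x = slot \<iota> q 0"
      using slot_coind_tr[OF inj q(1), of M a q x] 0 by simp
  qed
qed

text \<open>For \<open>a \<in> Q\<close> the point \<open>a\<close> is itself the least element of
  \<open>Q\<close> above \<open>a\<close>. The section \<open>s\<close> spreads \<open>x\<close> out
  to the family of its images, and the retraction reads off the member at \<open>a\<close>.\<close>

lemma retract_coind:
  assumes inj: "inj_on \<iota> Q" and M: "pmodule Q M"
  shows "retract Q M (coind \<iota> Q M)"
proof -
  let ?N = "coind \<iota> Q M"
  define s where "s = (\<lambda>a x m. if \<exists>q\<in>Q. a \<le> q \<and> fst (prod_decode m) = \<iota> q
    then tr M a (THE q. q \<in> Q \<and> fst (prod_decode m) = \<iota> q) x (snd (prod_decode m)) else 0)"
  have slot_s: "slot \<iota> q (s a x) = (if a \<le> q then tr M a q x else 0)" if q: "q \<in> Q" for q a x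
  proof -
    have "(THE q'. q' \<in> Q \<and> \<iota> q = \<iota> q') = q" using q inj by (auto simp: inj_on_def)
    moreover have "(\<exists>q'\<in>Q. a \<le> q' \<and> \<iota> q = \<iota> q') \<longleftrightarrow> a \<le> q" using q inj by (auto simp: inj_on_def)
    ultimately show ?thesis by (simp add: slot_def s_def fun_eq_iff)
  qed
  note L = pmodule_lin_map[OF M] and S = coind_subspace[OF M]
  have s_in: "s a x \<in> sp ?N a" if a: "a \<in> Q" and x: "x \<in> sp M a" for a x
  proof -
    have "\<exists>q\<in>Q. a \<le> q \<and> fst (prod_decode m) = \<iota> q" if "s a x m \<noteq> 0" for m
      using that by (auto simp: s_def split: if_splits)
    then show ?thesis
      unfolding coind_in using lin_mapD(1)[OF L[OF a] x] pmodule_tr_tr[OF M a _ _ _ _ x]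
      by (auto simp: slot_s dest: order_trans)
  qed
  have "lin_map (sp M a) (sp ?N a) (s a)" if a: "a \<in> Q" for a
  proof -
    note Ma = pmodule_subspace[OF M a]
    have "s a (x + y) = s a x + s a y" if x: "x \<in> sp M a" and y: "y \<in> sp M a" for x y
    proof (rule coind_eqI)
      show "s a (x + y) \<in> sp ?N a" by (rule s_in[OF a fspace.subspace_add[OF Ma x y]])
      show "s a x + s a y \<in> sp ?N a" by (rule fspace.subspace_add[OF S s_in[OF a x] s_in[OF a y]])
    qed (simp add: slot_s slot_add lin_mapD(2)[OF L[OF a] x y])
    moreover have "s a (fscale c x) = fscale c (s a x)" if x: "x \<in> sp M a" for c x
    proof (rule coind_eqI)
      show "s a (fscale c x) \<in> sp ?N a" by (rule s_in[OF a fspace.subspace_scale[OF Ma x]])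
      show "fscale c (s a x) \<in> sp ?N a" by (rule fspace.subspace_scale[OF S s_in[OF a x]])
    qed (simp add: slot_s slot_scale lin_mapD(3)[OF L[OF a] x])
    ultimately show ?thesis using s_in[OF a] by (auto simp: lin_map_def)
  qed
  moreover have "s b (tr M a b x) = tr ?N a b (s a x)" if ab: "a \<in> Q" "b \<in> Q" "a \<le> b" and x: "x \<in> sp M a" for a b x
  proof (rule coind_eqI)
    show "s b (tr M a b x) \<in> sp ?N b" by (rule s_in[OF ab(2) lin_mapD(1)[OF L[OF ab] x]])
    show "tr ?N a b (s a x) \<in> sp ?N b" by (rule coind_tr_in[OF inj s_in[OF ab(1) x] ab(3)])
    fix q assume q: "q \<in> Q" "b \<le> q"
    then have "a \<le> q" using ab(3) by (meson order_trans)
    then show "slot \<iota> q (s b (tr M a b x)) = slot \<iota> q (tr ?N a b (s a x))"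
      using q pmodule_tr_tr[OF M ab(1,2) q(1) ab(3) q(2) x] by (simp add: slot_s slot_coind_tr[OF inj])
  qed
  ultimately have "pmorphism Q M ?N s" by (simp add: pmorphism_def)
  moreover have "pmorphism Q ?N M (slot \<iota>)"
    unfolding pmorphism_def lin_map_def image_subset_iff
    by (auto simp: slot_add slot_scale slot_coind_tr[OF inj] coindD)
  moreover have "slot \<iota> a (s a x) = x" if "a \<in> Q" "x \<in> sp M a" for a x
    using slot_s[OF that(1)] pmodule_tr_id[OF M that] by simp
  ultimately show ?thesis unfolding retract_def by blast
qed

theorem theorem1p2:
  fixes P Q :: "'p::order set"
  assumes "finite P" and "Q \<subseteq> P"
  shows "int_res_gldim TYPE('k::field) Q \<le> int_res_gldim TYPE('k) P"
proof -
  have Q: "finite Q" using assms finite_subset by blast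
  obtain \<iota> :: "'p \<Rightarrow> nat" where inj: "inj_on \<iota> Q"
    using finite_imp_inj_to_nat_seg[OF Q] by blast
  have "int_res_dim Q M \<le> int_res_gldim TYPE('k) P" if M: "pmodule Q M" for M :: "('p, nat, 'k) rep"
  proof -
    define N where "N = coind \<iota> Q M"
    have N: "pmodule P N" "torsion_free P Q N" "retract Q M N"
      unfolding N_def using coind_pmodule[OF Q inj M] coind_torsion_free[OF inj M] retract_coind[OF inj M] .
    have "\<exists>M'. syzygy Q M i M' \<and> zero_module Q M'" if syz: "syzygy P N i N'" and N': "zero_module P N'" for i N'
    proof -
      obtain M' where "pmodule Q M'" "syzygy Q M i M'" "retract Q M' N'"
        using syzygy_retract[OF assms M N syz] by blast
      moreover have "zero_module Q N'" using N' assms(2) by (auto simp: zero_module_def)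
      ultimately show ?thesis using retract_zero_module by blast
    qed
    \<comment> \<open>Every length admissible for \<open>N\<close> is admissible for
      \<open>M\<close>, and the infimum over a larger set is smaller. If no resolution of
      \<open>N\<close> terminates, the right-hand side is infinite.\<close>
    then have "int_res_dim Q M \<le> int_res_dim P N"
      unfolding int_res_dim_def by (intro Inf_superset_mono) blast
    also have "\<dots> \<le> int_res_gldim TYPE('k) P"
      unfolding int_res_gldim_def using N(1) by (intro Sup_upper) blast
    finally show ?thesis .
  qed
  then show ?thesis
    unfolding int_res_gldim_def[of _ Q] by (intro Sup_least) blast
qed

end
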